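(* Let $Q$ be a discrete memoryless channel (in the asynchronous communication model described in the context). Suppose that for some constants $\alpha\ge 0$, $t_1\ge 0$, $t_2>1$, and some input distribution $P$ on $\mathcal X$ with $I(PQ)>0$, the inequalities $$\text{(a)}\quad \alpha<\inf_{\substack{V\in\mathcal P^{\mathcal Y|\mathcal X}\\ D((PV)_Y\|Q(\cdot|\star))<\frac{t_1\alpha}{\delta(t_1+t_2-1)}}} D\big((PV)_Y\,\|\,(PQ)_Y\big),$$ $$\text{(b)}\quad \alpha<\min_{\substack{V\in\mathcal P^{\mathcal Y|\mathcal X}\\ I(PV)\le \frac{t_2\alpha}{\delta(t_1+t_2-1)}}} D(PV\|PQ),$$ $$\text{(c)}\quad \frac{t_1}{t_2}<\frac{D((PQ)_Y\|Q(\cdot|\star))}{I(PQ)}$$ hold for some $\delta\in(0,1)$. Then the asynchronism exponent $\alpha$ is achievable at rate $I(PQ)/t_2$.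
   Context: Model. A discrete memoryless channel has finite input alphabet $\mathcal X$, finite output alphabet $\mathcal Y$, transition probabilities $Q(y|x)$, and a distinguished "noise" input symbol $\star\in\mathcal X$. Standing assumptions: for every $y\in\mathcal Y$ there is $x$ with $Q(y|x)>0$, and the capacity $C(Q)$ of the synchronized channel is strictly positive. A code consists of $M\ge 2$ equally likely messages, codewords $c^N(m)\in\mathcal X^N$, and a sequential decoder. The asynchronism level is an integer $A\ge1$: the start time $\nu$ is uniform on $\{1,\dots,A\}$, independent of the message. Given message $m$ and $\nu$, outputs $Y_1,Y_2,\dots$ are independent with $Y_i\sim Q(\cdot|\star)$ if $i\le\nu-1$ or $i\ge\nu+N$, and $Y_i\sim Q(\cdot|c_{i-\nu+1}(m))$ for $\nu\le i\le\nu+N-1$. The receiver knows $A$ and the code but not $\nu$. A decoder is $(\tau,\phi)$ with $\tau$ a stopping time w.r.t. $Y_1,Y_2,\dots$ and $\phi$ a function of $Y_1,\dots,Y_\tau$ returning a message. With $\mathbb P_{m,l},\mathbb E_{m,l}$ conditioning on message $m$ and $\nu=l$: $\mathbb P(\mathcal E)=\frac1{AM}\sum_{m,l}\mathbb P_{m,l}(\phi\neq m)$, $\mathbb E(\tau-\nu)^+=\frac1{AM}\sum_{m,l}\mathbb E_{m,l}(\tau-l)^+$, rate $R=\ln M/\mathbb E(\tau-\nu)^+$. An asynchronism exponent $\alpha$ is achievable at rate $R$ if for every $\varepsilon>0$ there is a code with (sufficiently large) blocklength $N$ operating at asynchronism level $A=e^{(\alpha-\varepsilon)N}$ with rate at least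 $R-\varepsilon$ and $\mathbb P(\mathcal E)\le\varepsilon$. Notation. $\mathcal P^{\mathcal Y|\mathcal X}$ is the set of conditional distributions $V(y|x)$. For a distribution $P$ on $\mathcal X$ and $V\in\mathcal P^{\mathcal Y|\mathcal X}$, $PV$ denotes the joint distribution $P(x)V(y|x)$ on $\mathcal X\times\mathcal Y$ and $(PV)_Y$ its $\mathcal Y$-marginal. For a joint distribution $J$, $I(J)$ is the mutual information induced by $J$. $D$ is Kullback–Leibler divergence (natural logs). An infimum over an empty set is $+\infty$. *)

theory Defs
  imports "HOL-Probability.Probability"
begin

definition KL :: "'a::finite pmf \<Rightarrow> 'a pmf \<Rightarrow> ereal" where
  "KL p q = (if \<exists>a. pmf p a > 0 \<and> pmf q a = 0 then \<infinity>
             else ereal (\<Sum>a | pmf p a > 0. pmf p a * ln (pmf p a / pmf q a)))"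

definition joint :: "'x pmf \<Rightarrow> ('x \<Rightarrow> 'y pmf) \<Rightarrow> ('x \<times> 'y) pmf" where
  "joint P V = bind_pmf P (\<lambda>x. map_pmf (\<lambda>y. (x, y)) (V x))"

definition out_marg :: "'x pmf \<Rightarrow> ('x \<Rightarrow> 'y pmf) \<Rightarrow> 'y pmf" where
  "out_marg P V = map_pmf snd (joint P V)"

definition mutual_info :: "('x::finite \<times> 'y::finite) pmf \<Rightarrow> real" where
  "mutual_info J = (\<Sum>z | pmf J z > 0.
      pmf J z * ln (pmf J z / (pmf (map_pmf fst J) (fst z) * pmf (map_pmf snd J) (snd z))))"

definition capacity :: "('x::finite \<Rightarrow> 'y::finite pmf) \<Rightarrow> real" where
  "capacity Q = (SUP P. mutual_info (joint P Q))"

(* distribution of output Y_i (times i = 1,2,...) given codeword function c (message m,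
   position 1..N), start time l; index 0 is unused (set to noise) *)
definition out_dist :: "('x \<Rightarrow> 'y pmf) \<Rightarrow> 'x \<Rightarrow> nat \<Rightarrow> (nat \<Rightarrow> nat \<Rightarrow> 'x)
    \<Rightarrow> nat \<Rightarrow> nat \<Rightarrow> nat \<Rightarrow> 'y pmf" where
  "out_dist Q star N c m l i =
     (if l \<le> i \<and> i \<le> l + N - 1 then Q (c m (i - l + 1)) else Q star)"

definition out_meas :: "('x \<Rightarrow> 'y pmf) \<Rightarrow> 'x \<Rightarrow> nat \<Rightarrow> (nat \<Rightarrow> nat \<Rightarrow> 'x)
    \<Rightarrow> nat \<Rightarrow> nat \<Rightarrow> (nat \<Rightarrow> 'y) measure" where
  "out_meas Q star N c m l = PiM UNIV (\<lambda>i. measure_pmf (out_dist Q star N c m l i))"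

definition stopping_time_seq :: "((nat \<Rightarrow> 'y) \<Rightarrow> enat) \<Rightarrow> bool" where
  "stopping_time_seq \<tau> \<longleftrightarrow>
     (\<forall>y y' n. \<tau> y = enat n \<longrightarrow> (\<forall>i\<in>{1..n}. y' i = y i) \<longrightarrow> \<tau> y' = enat n)"

definition err_event :: "((nat \<Rightarrow> 'y) \<Rightarrow> enat) \<Rightarrow> ('y list \<Rightarrow> nat) \<Rightarrow> nat \<Rightarrow> (nat \<Rightarrow> 'y) set" where
  "err_event \<tau> \<phi> m = {y. case \<tau> y of enat n \<Rightarrow> \<phi> (map y [1..<Suc n]) \<noteq> m | \<infinity> \<Rightarrow> True}"

definition err_prob :: "('x \<Rightarrow> 'y pmf) \<Rightarrow> 'x \<Rightarrow> nat \<Rightarrow> nat \<Rightarrow> nat \<Rightarrow> (nat \<Rightarrow> nat \<Rightarrow> 'x)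
    \<Rightarrow> ((nat \<Rightarrow> 'y) \<Rightarrow> enat) \<Rightarrow> ('y list \<Rightarrow> nat) \<Rightarrow> real" where
  "err_prob Q star A M N c \<tau> \<phi> =
     (\<Sum>m<M. \<Sum>l\<in>{1..A}. measure (out_meas Q star N c m l) (err_event \<tau> \<phi> m)) / (real A * real M)"

definition delay :: "('x \<Rightarrow> 'y pmf) \<Rightarrow> 'x \<Rightarrow> nat \<Rightarrow> nat \<Rightarrow> nat \<Rightarrow> (nat \<Rightarrow> nat \<Rightarrow> 'x)
    \<Rightarrow> ((nat \<Rightarrow> 'y) \<Rightarrow> enat) \<Rightarrow> ennreal" where
  "delay Q star A M N c \<tau> =
     (\<Sum>m<M. \<Sum>l\<in>{1..A}. \<integral>\<^sup>+ y. ennreal_of_enat (\<tau> y - enat l) \<partial>out_meas Q star N c m l)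
       / (of_nat A * of_nat M)"

(* alpha achievable at rate R. The rate condition  ln M / E(tau-nu)^+ \<ge> R - eps  is written as
   (R - eps)^+ * E(tau-nu)^+ \<le> ln M  in ennreal (covers E = 0 and E = \<infinity>). *)
definition achievable :: "('x \<Rightarrow> 'y pmf) \<Rightarrow> 'x \<Rightarrow> real \<Rightarrow> real \<Rightarrow> bool" where
  "achievable Q star \<alpha> R \<longleftrightarrow>
     (\<forall>\<epsilon>>0. \<exists>N0. \<forall>N\<ge>N0. \<exists>(M::nat) c \<tau> \<phi>.
        let A = nat \<lceil>exp ((\<alpha> - \<epsilon>) * real N)\<rceil> in
        N \<ge> 1 \<and> M \<ge> 2 \<and> stopping_time_seq \<tau> \<and>
        ennreal (R - \<epsilon>) * delay Q star A M N c \<tau> \<le> ennreal (ln (real M)) \<and>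
        err_prob Q star A M N c \<tau> \<phi> \<le> \<epsilon>)"

end

theory Submission
  imports Defs "HOL-Real_Asymp.Real_Asymp"
begin

text \<open>The decoder stops as soon as some codeword passes, on the last \<open>i\<close> outputs, two tests: the type of
  these outputs must look \<open>exp L1\<close> times more likely than pure noise, and the joint type with the codeword
  prefix must make that prefix \<open>exp L2\<close> times more likely than under the code distribution. Only two
  window lengths are needed: the full blocklength \<open>N\<close> and \<open>k \<approx> \<kappa> N\<close>, slightly above
  \<open>t2 ln M / I(PQ)\<close>. By the method of types a wrong codeword passes on noise with probability at most
  \<open>exp (- L1 - L2)\<close> and during transmission with probability at most \<open>exp (- L2)\<close>, up to polynomial
  factors. The true codeword fails at length \<open>k\<close> with vanishing probability by (c), so the typical delay
  is at most \<open>k\<close>, and it fails at length \<open>N\<close> with exponent larger than \<open>\<alpha>\<close> by (a) and (b), which makes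
  the contribution of the delays of order \<open>exp (\<alpha> N)\<close> negligible. Instead of using constant composition
  codewords, i.i.d. codewords are conditioned on having type close to \<open>P\<close> at lengths \<open>k\<close> and \<open>N\<close>; the
  exponents survive because they are attained on compact sets of joint laws. The delay bound then holds
  for every such code, and only the error probability is averaged over the random code.\<close>

section \<open>Types and false alarms\<close>

text \<open>The constants come from union bounds. With exp(\<beta> N) messages and about
  exp(\<alpha> N) times at which noise may raise a false alarm, L1 + L2 must exceed (\<alpha> +
  \<beta>) N, while a wrong codeword during transmission only asks L2 > \<beta> N. For L1 and L2
  close to t1 \<beta> N and t2 \<beta> N this means \<alpha> < (t1 + t2 - 1) \<beta> and t2 > 1;
  hence \<beta> = \<alpha> / (\<delta> (t1 + t2 - 1)), and t1 \<beta>, t2 \<beta> are the radii in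
  (a) and (b). At length \<kappa> N the same thresholds are t1 \<beta> / \<kappa> and t2 \<beta> /
  \<kappa> per letter. For \<kappa> > t2 \<beta> / I(PQ) the second is below I(PQ) and, by (c), the
  first is below the divergence of the output law from noise, while \<beta> / \<kappa> approaches
  I(PQ) / t2. The Sanov bound yields joint divergences only, so (a), a statement on output laws,
  enters through data processing. The obstacle to uniformity near the input law P is the boundary,
  where divergences may jump to infinity: they are therefore written with x ln x on a closed set of
  laws on which they are finite and continuous.\<close>

definition seqs :: "nat \<Rightarrow> (nat \<Rightarrow> 'a::finite) set" where
  "seqs i = PiE {1..i} (\<lambda>_. UNIV)"

definition cnt :: "(nat \<Rightarrow> 'a) \<Rightarrow> nat \<Rightarrow> 'a \<Rightarrow> nat" where
  "cnt z i a = card {j\<in>{1..i}. z j = a}"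

lemma finite_seqs [simp]: "finite (seqs i :: (nat \<Rightarrow> 'a::finite) set)"
  by (auto simp: seqs_def intro!: finite_PiE)

lemma cnt_le: "cnt z i a \<le> i"
proof -
  have "cnt z i a \<le> card {1..i}" unfolding cnt_def by (intro card_mono) auto
  then show ?thesis by simp
qed

lemma cnt_pos: "j \<in> {1..i} \<Longrightarrow> 0 < cnt z i (z j)"
  unfolding cnt_def by (subst card_gt_0_iff) auto

lemma cnt_sum:
  fixes z :: "nat \<Rightarrow> 'a::finite"
  shows "(\<Sum>a\<in>UNIV. cnt z i a) = i"
proof -
  have "(\<Sum>a\<in>UNIV. cnt z i a) = (\<Sum>a\<in>UNIV. \<Sum>j\<in>{j\<in>{1..i}. z j = a}. 1)"
    by (simp add: cnt_def)
  also have "\<dots> = (\<Sum>j\<in>{1..i}. 1)"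
    by (rule sum.group) auto
  finally show ?thesis by simp
qed

lemma cnt_pair_fst:
  fixes u :: "nat \<Rightarrow> 'b::finite"
  shows "(\<Sum>b\<in>UNIV. cnt (\<lambda>j. (x j, u j)) i (a, b)) = cnt x i a"
proof -
  have "(\<Sum>b\<in>UNIV. cnt (\<lambda>j. (x j, u j)) i (a, b))
      = (\<Sum>b\<in>UNIV. \<Sum>j\<in>{j\<in>{j\<in>{1..i}. x j = a}. u j = b}. 1)"
    by (simp add: cnt_def conj_assoc)
  also have "\<dots> = (\<Sum>j\<in>{j\<in>{1..i}. x j = a}. 1)"
    by (rule sum.group) auto
  finally show ?thesis by (simp add: cnt_def)
qed

lemma cnt_pair_snd:
  fixes x :: "nat \<Rightarrow> 'a::finite"
  shows "(\<Sum>a\<in>UNIV. cnt (\<lambda>j. (x j, u j)) i (a, b)) = cnt u i b"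
proof -
  have "(\<Sum>a\<in>UNIV. cnt (\<lambda>j. (x j, u j)) i (a, b))
      = (\<Sum>a\<in>UNIV. \<Sum>j\<in>{j\<in>{j\<in>{1..i}. u j = b}. x j = a}. 1)"
    by (auto simp: cnt_def intro!: sum.cong arg_cong[where f=card])
  also have "\<dots> = (\<Sum>j\<in>{j\<in>{1..i}. u j = b}. 1)"
    by (rule sum.group) auto
  finally show ?thesis by (simp add: cnt_def)
qed

lemma prod_cnt:
  fixes f :: "'a::finite \<Rightarrow> real"
  shows "(\<Prod>j=1..i. f (z j)) = (\<Prod>a\<in>UNIV. f a ^ cnt z i a)"
proof -
  have "(\<Prod>a\<in>UNIV. f a ^ cnt z i a) = (\<Prod>a\<in>UNIV. \<Prod>j\<in>{j\<in>{1..i}. z j = a}. f (z j))"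
    by (intro prod.cong refl) (simp add: cnt_def)
  also have "\<dots> = (\<Prod>j\<in>{1..i}. f (z j))"
    by (rule prod.group) auto
  finally show ?thesis by simp
qed

text \<open>A letter absent from the word has count 0 and contributes nothing on either side,
  whatever \<open>ln (f a)\<close> is; positivity is therefore asked only along the word.\<close>

lemma prod_eq_exp_cnt:
  fixes f :: "'a::finite \<Rightarrow> real"
  assumes pos: "\<And>j. j \<in> {1..i} \<Longrightarrow> 0 < f (z j)"
  shows "(\<Prod>j=1..i. f (z j)) = exp (\<Sum>a\<in>UNIV. real (cnt z i a) * ln (f a))"
proof -
  have "f a ^ cnt z i a = exp (real (cnt z i a) * ln (f a))" for a
  proof (cases "cnt z i a = 0")
    case False
    then obtain j where "j \<in> {1..i}" "z j = a"
      unfolding cnt_def by (metis (mono_tags, lifting) card.empty empty_Collect_eq)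
    then have "0 < f a" using pos by auto
    then show ?thesis by (simp add: exp_of_nat_mult)
  qed simp
  then show ?thesis by (simp only: prod_cnt) (simp add: exp_sum)
qed

section \<open>Change of measure over types\<close>

lemma sum_seqs_prod:
  fixes g :: "nat \<Rightarrow> 'a::finite \<Rightarrow> real"
  shows "(\<Sum>u\<in>seqs i. \<Prod>j=1..i. g j (u j)) = (\<Prod>j=1..i. \<Sum>a\<in>UNIV. g j a)"
  unfolding seqs_def by (subst prod_sum_PiE) auto

text \<open>The method of types as a change of measure: each \<open>z\<close> is charged to the
  kernel of its own type, and every kernel has mass at most one. No estimate of the size of a type
  class enters, only the number of types.\<close>

lemma sum_le_by_types:
  fixes f :: "'z \<Rightarrow> real"
  assumes "finite S" "finite T" "0 \<le> e"
    and ty: "\<And>z. z \<in> S \<Longrightarrow> ty z \<in> T \<and> f z \<le> e * g (ty z) z"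
    and nn: "\<And>t z. t \<in> T \<Longrightarrow> z \<in> S \<Longrightarrow> 0 \<le> g t z"
    and one: "\<And>t. t \<in> T \<Longrightarrow> (\<Sum>z\<in>S. g t z) \<le> 1"
  shows "(\<Sum>z\<in>S. f z) \<le> real (card T) * e"
proof -
  have "(\<Sum>z\<in>S. f z) \<le> (\<Sum>z\<in>S. \<Sum>t\<in>T. e * g t z)"
  proof (rule sum_mono)
    fix z assume z: "z \<in> S"
    have "e * g (ty z) z \<le> (\<Sum>t\<in>T. e * g t z)"
      using z ty[OF z] nn assms by (intro member_le_sum) auto
    then show "f z \<le> (\<Sum>t\<in>T. e * g t z)" using ty[OF z] by linarith
  qed
  also have "\<dots> = (\<Sum>t\<in>T. e * (\<Sum>z\<in>S. g t z))"
    by (subst sum.swap) (simp add: sum_distrib_left)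
  also have "\<dots> \<le> (\<Sum>t\<in>T. e * 1)"
    by (intro sum_mono mult_left_mono one) (use assms in auto)
  finally show ?thesis by simp
qed

text \<open>Count vectors that do not sum to \<open>i\<close> are included, since only polynomial
  growth of the cardinality matters.\<close>

definition types :: "nat \<Rightarrow> ('a::finite \<Rightarrow> nat) set" where
  "types i = PiE UNIV (\<lambda>_. {..i})"

lemma finite_types [simp]: "finite (types i)"
  by (auto simp: types_def intro!: finite_PiE)

lemma card_types: "card (types i :: ('a::finite \<Rightarrow> nat) set) = (i + 1) ^ CARD('a)"
  by (simp add: types_def card_PiE)

lemma cnt_in_types: "cnt z i \<in> types i"
  by (auto simp: types_def cnt_le)

text \<open>An inequality, because a zero total makes every quotient 0; the change of measure works
  with sub-probability kernels.\<close>

lemma sum_ratio_le_1: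
  fixes t :: "'a::finite \<Rightarrow> nat"
  shows "(\<Sum>a\<in>UNIV. real (t a) / real (\<Sum>a\<in>UNIV. t a)) \<le> 1"
  by (simp add: sum_divide_distrib[symmetric])

lemma sum_kernel_le_1:
  fixes g :: "nat \<Rightarrow> 'a::finite \<Rightarrow> real"
  assumes "S \<subseteq> seqs i" "\<And>j a. 0 \<le> g j a" "\<And>j. (\<Sum>a\<in>UNIV. g j a) \<le> 1"
  shows "(\<Sum>u\<in>S. \<Prod>j=1..i. g j (u j)) \<le> 1"
proof -
  have "(\<Sum>u\<in>S. \<Prod>j=1..i. g j (u j)) \<le> (\<Sum>u\<in>seqs i. \<Prod>j=1..i. g j (u j))"
    by (intro sum_mono2) (use assms in \<open>auto intro!: prod_nonneg\<close>)
  also have "\<dots> = (\<Prod>j=1..i. \<Sum>a\<in>UNIV. g j a)" by (rule sum_seqs_prod)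
  also have "\<dots> \<le> 1" by (intro prod_le_1) (use assms in \<open>auto intro!: sum_nonneg\<close>)
  finally show ?thesis .
qed

text \<open>Multiplicative forms of \<open>L \<le> i * D(type || W)\<close> and \<open>L \<le> i * D(J || P \<times> J_Y)\<close>, which need no
  convention for infinite divergences. The second divergence is \<open>I(J) + D(J_X || P)\<close>, so it agrees with
  the mutual information when the input type is \<open>P\<close>.\<close>

definition noise_test :: "'y pmf \<Rightarrow> real \<Rightarrow> nat \<Rightarrow> (nat \<Rightarrow> 'y::finite) \<Rightarrow> bool" where
  "noise_test W L i u \<longleftrightarrow>
     exp L * (\<Prod>j=1..i. pmf W (u j)) \<le> (\<Prod>j=1..i. real (cnt u i (u j)) / real i)"

definition codeword_test :: "'x pmf \<Rightarrow> real \<Rightarrow> nat \<Rightarrow> (nat \<Rightarrow> 'x::finite) \<Rightarrow> (nat \<Rightarrow> 'y::finite) \<Rightarrow> bool" where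
  "codeword_test P L i x u \<longleftrightarrow>
     exp L * (\<Prod>j=1..i. pmf P (x j)) \<le>
     (\<Prod>j=1..i. real (cnt (\<lambda>j. (x j, u j)) i (x j, u j)) / real (cnt u i (u j)))"

text \<open>Passing the test says that noise produces \<open>u\<close> with at most exp(-L) times
  the probability given to \<open>u\<close> by i.i.d. letters drawn from its own type. Summing over
  the types costs a polynomial factor.\<close>

lemma noise_false_alarm:
  fixes W :: "'y::finite pmf"
  shows "(\<Sum>u\<in>{u\<in>seqs i. noise_test W L i u}. \<Prod>j=1..i. pmf W (u j))
     \<le> real ((i + 1) ^ CARD('y)) * exp (- L)"
proof -
  have "(\<Sum>u\<in>{u\<in>seqs i. noise_test W L i u}. \<Prod>j=1..i. pmf W (u j))
     \<le> real (card ({t \<in> types i. (\<Sum>a\<in>UNIV. t a) = i} :: ('y \<Rightarrow> nat) set)) * exp (- L)"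
  proof (rule sum_le_by_types[where ty = "\<lambda>u. cnt u i"
        and g = "\<lambda>t u. \<Prod>j=1..i. real (t (u j)) / real i"])
    fix u assume "u \<in> {u \<in> seqs i. noise_test W L i u}"
    then show "cnt u i \<in> {t \<in> types i. sum t UNIV = i} \<and>
       (\<Prod>j = 1..i. pmf W (u j)) \<le> exp (- L) * (\<Prod>j = 1..i. real (cnt u i (u j)) / real i)"
      by (auto simp: cnt_in_types cnt_sum noise_test_def exp_minus field_simps)
  next
    fix t :: "'y \<Rightarrow> nat" assume "t \<in> {t \<in> types i. sum t UNIV = i}"
    then have "i = sum t UNIV" by simp
    then show "(\<Sum>u\<in>{u \<in> seqs i. noise_test W L i u}. \<Prod>j = 1..i. real (t (u j)) / real i) \<le> 1"
      using sum_ratio_le_1[of t] by (intro sum_kernel_le_1) (auto simp del: of_nat_sum)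
  qed (auto intro!: prod_nonneg simp del: of_nat_sum)
  also have "\<dots> \<le> real (card (types i :: ('y \<Rightarrow> nat) set)) * exp (- L)"
    by (intro mult_right_mono of_nat_mono card_mono) auto
  finally show ?thesis by (simp add: card_types)
qed

lemma prod_split_at:
  fixes f :: "nat \<Rightarrow> real"
  assumes "i \<le> N"
  shows "(\<Prod>j=1..N. f j) = (\<Prod>j=1..i. f j) * (\<Prod>j=Suc i..N. f j)"
  using assms prod.ub_add_nat[of 1 i f "N - i"] by simp

text \<open>Here \<open>u\<close> is fixed and the codeword is random, so the same bound serves for
  every origin of the outputs: noise, another codeword, or a window across both.\<close>

lemma code_false_alarm:
  fixes P :: "'x::finite pmf" and u :: "nat \<Rightarrow> 'y::finite"
  assumes "i \<le> N"
  shows "(\<Sum>x\<in>{x\<in>seqs N. codeword_test P L i x u}. \<Prod>j=1..N. pmf P (x j))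
     \<le> real ((i + 1) ^ CARD('x \<times> 'y)) * exp (- L)"
proof -
  \<comment> \<open>The comparison law draws the letter from the conditional type given
    \<open>u j\<close> inside the window and keeps \<open>P\<close> beyond it, so a test on a prefix
    is handled on the full codeword.\<close>
  define g where "g = (\<lambda>(t :: 'x \<times> 'y \<Rightarrow> nat) j a.
     if j \<le> i then real (t (a, u j)) / real (\<Sum>a\<in>UNIV. t (a, u j)) else pmf P a)"
  have "(\<Sum>x\<in>{x\<in>seqs N. codeword_test P L i x u}. \<Prod>j=1..N. pmf P (x j))
     \<le> real (card (types i :: ('x \<times> 'y \<Rightarrow> nat) set)) * exp (- L)"
  proof (rule sum_le_by_types[where ty = "\<lambda>x. cnt (\<lambda>j. (x j, u j)) i"
        and g = "\<lambda>t x. \<Prod>j=1..N. g t j (x j)"])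
    fix x assume x: "x \<in> {x\<in>seqs N. codeword_test P L i x u}"
    let ?t = "cnt (\<lambda>j. (x j, u j)) i"
    have 1: "(\<Prod>j=1..i. g ?t j (x j)) = (\<Prod>j=1..i. real (?t (x j, u j)) / real (cnt u i (u j)))"
      by (intro prod.cong refl) (simp add: g_def cnt_pair_snd del: of_nat_sum)
    have 2: "(\<Prod>j=Suc i..N. g ?t j (x j)) = (\<Prod>j=Suc i..N. pmf P (x j))"
      by (intro prod.cong refl) (simp add: g_def)
    have 3: "(\<Prod>j=1..i. pmf P (x j)) \<le> exp (- L) * (\<Prod>j=1..i. g ?t j (x j))"
      using x unfolding 1 by (simp add: codeword_test_def exp_minus field_simps)
    have "(\<Prod>j=1..N. pmf P (x j)) \<le> exp (- L) * (\<Prod>j=1..N. g ?t j (x j))"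
      unfolding prod_split_at[OF assms] 2 mult.assoc[symmetric]
      by (intro mult_right_mono 3 prod_nonneg) auto
    then show "?t \<in> types i \<and> (\<Prod>j=1..N. pmf P (x j)) \<le> exp (- L) * (\<Prod>j=1..N. g ?t j (x j))"
      by (simp add: cnt_in_types)
  next
    fix t :: "'x \<times> 'y \<Rightarrow> nat"
    have "(\<Sum>a\<in>UNIV. g t j a) \<le> 1" for j
      using sum_ratio_le_1[of "\<lambda>a. t (a, u j)"] by (cases "j \<le> i") (simp_all add: g_def sum_pmf_eq_1 del: of_nat_sum)
    then show "(\<Sum>x\<in>{x\<in>seqs N. codeword_test P L i x u}. \<Prod>j=1..N. g t j (x j)) \<le> 1"
      by (intro sum_kernel_le_1) (auto simp: g_def sum_nonneg)
  qed (auto intro!: prod_nonneg simp: g_def sum_nonneg)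
  then show ?thesis by (simp add: card_types)
qed

section \<open>A conditional Sanov bound\<close>

lemma sum_UNIV_pair:
  fixes f :: "'a::finite \<times> 'b::finite \<Rightarrow> real"
  shows "(\<Sum>z\<in>UNIV. f z) = (\<Sum>a\<in>UNIV. \<Sum>b\<in>UNIV. f (a, b))"
  unfolding sum.cartesian_product by (simp add: case_prod_beta)

definition xlnx :: "real \<Rightarrow> real" where "xlnx x = x * ln x"

text \<open>At 0 this is the limit of x ln x. It makes entropies continuous up to the boundary of
  the simplex, as the compactness arguments require.\<close>

lemma continuous_xlnx: "continuous_on {0..} xlnx"
proof -
  have "continuous (at x within {0..}) xlnx" if "0 \<le> x" for x
  proof (cases "x = 0")
    case True
    have "((\<lambda>x::real. x * ln x) \<longlongrightarrow> 0) (at_right 0)" by real_asymp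
    then show ?thesis
      using True by (simp add: continuous_within xlnx_def[abs_def] at_within_Ici_at_right)
  next
    case False
    then have "isCont (\<lambda>x. x * ln x) x" using that by (intro continuous_intros) auto
    then show ?thesis by (simp add: xlnx_def[abs_def] continuous_at_imp_continuous_at_within)
  qed
  then show ?thesis by (simp add: continuous_on_eq_continuous_within)
qed

lemma continuous_on_xlnx [continuous_intros]:
  assumes "continuous_on S f" "\<And>x. x \<in> S \<Longrightarrow> 0 \<le> f x"
  shows "continuous_on S (\<lambda>x. xlnx (f x))"
  by (rule continuous_on_compose2[OF continuous_xlnx assms(1)]) (use assms in auto)

text \<open>Up to sign this is H(Y|X) = H(X,Y) - H(X); the right side contains no quotient and is
  continuous at vanishing marginals.\<close>

lemma sum_ln_ratio_fst:
  fixes p :: "'x::finite \<times> 'y::finite \<Rightarrow> real"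
  assumes nn: "\<And>z. 0 \<le> p z"
  shows "(\<Sum>z\<in>UNIV. p z * ln (p z / (\<Sum>b\<in>UNIV. p (fst z, b))))
      = (\<Sum>z\<in>UNIV. xlnx (p z)) - (\<Sum>a\<in>UNIV. xlnx (\<Sum>b\<in>UNIV. p (a, b)))"
proof -
  have "p (a, b) * ln (p (a, b) / (\<Sum>b\<in>UNIV. p (a, b)))
      = xlnx (p (a, b)) - p (a, b) * ln (\<Sum>b\<in>UNIV. p (a, b))" for a b
  proof (cases "p (a, b) = 0")
    case False
    then have "0 < p (a, b)" using nn[of "(a, b)"] by linarith
    moreover have "p (a, b) \<le> (\<Sum>b\<in>UNIV. p (a, b))" by (intro member_le_sum) (auto simp: nn)
    ultimately show ?thesis by (simp add: xlnx_def ln_div right_diff_distrib)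
  qed (simp add: xlnx_def)
  then show ?thesis
    by (simp add: sum_UNIV_pair sum_subtractf xlnx_def sum_distrib_right)
qed

lemma sum_UNIV_swap:
  fixes f :: "'a::finite \<times> 'b::finite \<Rightarrow> real"
  shows "(\<Sum>z\<in>UNIV. f (snd z, fst z)) = (\<Sum>z\<in>UNIV. f z)"
  by (simp add: sum_UNIV_pair) (rule sum.swap)

lemma sum_ln_ratio_snd:
  fixes p :: "'x::finite \<times> 'y::finite \<Rightarrow> real"
  assumes nn: "\<And>z. 0 \<le> p z"
  shows "(\<Sum>z\<in>UNIV. p z * ln (p z / (\<Sum>a\<in>UNIV. p (a, snd z))))
      = (\<Sum>z\<in>UNIV. xlnx (p z)) - (\<Sum>b\<in>UNIV. xlnx (\<Sum>a\<in>UNIV. p (a, b)))"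
  using sum_ln_ratio_fst[of "\<lambda>z. p (snd z, fst z)"] nn
    sum_UNIV_swap[of "\<lambda>z. p z * ln (p z / (\<Sum>a\<in>UNIV. p (a, snd z)))"]
    sum_UNIV_swap[of "\<lambda>z. xlnx (p z)"]
  by simp

text \<open>Termwise ln x \<le> x - 1 at x = q / p, with equality only at x = 1. Mass below one is
  allowed for \<open>q\<close>, since a deficit only increases the divergence.\<close>

lemma gibbs:
  fixes p q :: "'a::finite \<Rightarrow> real"
  assumes p: "\<And>a. 0 \<le> p a" "(\<Sum>a\<in>UNIV. p a) = 1"
    and q: "\<And>a. 0 \<le> q a" "(\<Sum>a\<in>UNIV. q a) \<le> 1" and ac: "\<And>a. q a = 0 \<Longrightarrow> p a = 0"
  shows "0 \<le> (\<Sum>a\<in>UNIV. p a * ln (p a / q a))"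
    and "(\<Sum>a\<in>UNIV. p a * ln (p a / q a)) \<le> 0 \<Longrightarrow> p = q"
proof -
  have pos: "0 < q a" if "0 < p a" for a
    using that ac[of a] q(1)[of a] by linarith
  have bound: "p a - q a \<le> p a * ln (p a / q a)" for a
  proof (cases "p a = 0")
    case False
    then have *: "0 < p a" "0 < q a" using p(1)[of a] pos[of a] by linarith+
    then have "ln (q a / p a) \<le> q a / p a - 1" by (intro ln_le_minus_one) auto
    then have "p a * ln (q a / p a) \<le> p a * (q a / p a - 1)" using * by (intro mult_left_mono) auto
    then show ?thesis using * by (simp add: ln_div algebra_simps)
  qed (use q in simp)
  have "(\<Sum>a\<in>UNIV. p a - q a) \<le> (\<Sum>a\<in>UNIV. p a * ln (p a / q a))"
    by (intro sum_mono bound)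
  then show "0 \<le> (\<Sum>a\<in>UNIV. p a * ln (p a / q a))"
    using p(2) q(2) by (simp add: sum_subtractf)
  assume le: "(\<Sum>a\<in>UNIV. p a * ln (p a / q a)) \<le> 0"
  have "(\<Sum>a\<in>UNIV. p a * ln (p a / q a) - (p a - q a)) = 0"
  proof (rule antisym)
    show "(\<Sum>a\<in>UNIV. p a * ln (p a / q a) - (p a - q a)) \<le> 0"
      using le p(2) q(2) by (simp add: sum_subtractf)
    show "0 \<le> (\<Sum>a\<in>UNIV. p a * ln (p a / q a) - (p a - q a))"
      by (intro sum_nonneg) (use bound in auto)
  qed
  then have eq: "p a * ln (p a / q a) = p a - q a" for a
    using bound by (subst (asm) sum_nonneg_eq_0_iff) auto
  show "p = q"
  proof
    fix a
    show "p a = q a"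
    proof (cases "p a = 0")
      case False
      then have *: "0 < p a" "0 < q a" using p(1)[of a] pos[of a] by linarith+
      then have "ln (q a / p a) = q a / p a - 1"
        using eq[of a] by (simp add: ln_div field_simps)
      then have "q a / p a = 1" using * by (intro ln_eq_minus_one) auto
      then show ?thesis using * by simp
    qed (use eq[of a] in auto)
  qed
qed

text \<open>Joint laws are encoded as vectors, so that closed bounded sets of them are
  compact.\<close>

definition marg_fst :: "real^('x::finite \<times> 'y::finite) \<Rightarrow> 'x \<Rightarrow> real" where
  "marg_fst J a = (\<Sum>b\<in>UNIV. J $ (a, b))"

definition marg_snd :: "real^('x::finite \<times> 'y::finite) \<Rightarrow> 'y \<Rightarrow> real" where
  "marg_snd J b = (\<Sum>a\<in>UNIV. J $ (a, b))"

text \<open>D(J || J_X Q), relative to the input marginal of \<open>J\<close> itself; for J_X = P it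
  is D(PV || PQ). The formula is the divergence only where \<open>J\<close> vanishes together with
  \<open>Q\<close>, which \<open>feasible\<close> ensures.\<close>

definition cond_div :: "('x::finite \<Rightarrow> 'y::finite pmf) \<Rightarrow> real^('x \<times> 'y) \<Rightarrow> real" where
  "cond_div Q J = (\<Sum>z\<in>UNIV. xlnx (J $ z)) - (\<Sum>a\<in>UNIV. xlnx (marg_fst J a))
     - (\<Sum>z\<in>UNIV. J $ z * ln (pmf (Q (fst z)) (snd z)))"

definition feasible :: "('x::finite \<Rightarrow> 'y::finite pmf) \<Rightarrow> (real^('x \<times> 'y)) set" where
  "feasible Q = {J. (\<forall>z. 0 \<le> J $ z) \<and> (\<Sum>z\<in>UNIV. J $ z) = 1 \<and>
     (\<forall>z. pmf (Q (fst z)) (snd z) = 0 \<longrightarrow> J $ z = 0)}"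

definition emp_type :: "(nat \<Rightarrow> 'x) \<Rightarrow> (nat \<Rightarrow> 'y) \<Rightarrow> nat \<Rightarrow> real^('x::finite \<times> 'y::finite)" where
  "emp_type x u i = (\<chi> z. real (cnt (\<lambda>j. (x j, u j)) i z) / real i)"

lemma feasible_nonneg: "J \<in> feasible Q \<Longrightarrow> 0 \<le> J $ z"
  unfolding feasible_def by blast

lemma marg_fst_nonneg: "J \<in> feasible Q \<Longrightarrow> 0 \<le> marg_fst J a"
  by (auto simp: feasible_def marg_fst_def intro: sum_nonneg)

lemma marg_snd_nonneg: "J \<in> feasible Q \<Longrightarrow> 0 \<le> marg_snd J b"
  by (auto simp: feasible_def marg_snd_def intro: sum_nonneg)

lemma compact_feasible: "compact (feasible Q)"
proof -
  have "closed (feasible Q)"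
    unfolding feasible_def
    by (intro closed_Collect_conj closed_Collect_all closed_Collect_imp closed_Collect_le
        closed_Collect_eq open_Collect_const continuous_intros)
  moreover have "bounded (feasible Q)"
  proof (rule boundedI)
    fix J assume J: "J \<in> feasible Q"
    have "norm J \<le> (\<Sum>z\<in>UNIV. \<bar>J $ z\<bar>)" by (rule norm_le_l1_cart)
    also have "\<dots> = (\<Sum>z\<in>UNIV. J $ z)" using J by (intro sum.cong refl) (auto simp: feasible_def)
    also have "\<dots> = 1" using J by (simp add: feasible_def)
    finally show "norm J \<le> 1" .
  qed
  ultimately show ?thesis by (simp add: compact_eq_bounded_closed)
qed

lemma continuous_marg [continuous_intros]:
  "continuous_on S (\<lambda>J. marg_fst J a)" "continuous_on S (\<lambda>J. marg_snd J b)"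
  unfolding marg_fst_def marg_snd_def by (intro continuous_intros)+

lemma continuous_cond_div: "continuous_on (feasible Q) (cond_div Q)"
  unfolding cond_div_def[abs_def]
  by (intro continuous_intros) (auto simp: marg_fst_nonneg, auto simp: feasible_def)

text \<open>The divergence is continuous on the compact set of feasible joint laws, so a strict bound on
  the slice with input law \<open>P\<close> survives, with a margin, on a neighbourhood of that slice.\<close>

lemma cond_div_gap:
  fixes Q :: "'x::finite \<Rightarrow> 'y::finite pmf"
  assumes "closed C"
    and gt: "\<And>J. J \<in> feasible Q \<Longrightarrow> J \<in> C \<Longrightarrow> marg_fst J = pmf P \<Longrightarrow> \<alpha> < cond_div Q J"
  shows "\<exists>\<eta>>0. \<exists>\<gamma>>0. \<forall>J\<in>feasible Q \<inter> C.
    (\<forall>a. \<bar>marg_fst J a - pmf P a\<bar> < \<eta>) \<longrightarrow> \<alpha> + \<gamma> \<le> cond_div Q J"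
proof -
  define K where "K = feasible Q \<inter> C"
  define dev where "dev = (\<lambda>J :: real^('x \<times> 'y). \<Sum>a\<in>UNIV. \<bar>marg_fst J a - pmf P a\<bar>)"
  have K: "compact K" unfolding K_def using compact_feasible assms(1) by blast
  have cont: "continuous_on K (cond_div Q)" "continuous_on K dev"
    unfolding dev_def K_def
    by (rule continuous_on_subset[OF continuous_cond_div], simp) (intro continuous_intros)
  have dev0: "marg_fst J = pmf P" if "dev J = 0" for J
    using that unfolding dev_def by (subst (asm) sum_nonneg_eq_0_iff) auto
  have sub: "compact {J \<in> K. f J \<le> c}" if "continuous_on K f" for f :: "real^('x \<times> 'y) \<Rightarrow> real" and c
  proof -
    have "closed (K \<inter> f -` {..c})"
      using that K by (intro continuous_closed_preimage) (auto simp: compact_imp_closed)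
    then have "compact (K \<inter> (K \<inter> f -` {..c}))" using K by blast
    moreover have "K \<inter> (K \<inter> f -` {..c}) = {J \<in> K. f J \<le> c}" by auto
    ultimately show ?thesis by simp
  qed
  \<comment> \<open>The divergence attains its minimum on the compact slice; half of the excess over
    \<alpha> is the margin, so the inequality stays strict for the next step.\<close>
  have "\<exists>\<gamma>>0. \<forall>J\<in>K. dev J \<le> 0 \<longrightarrow> \<alpha> + \<gamma> < cond_div Q J"
  proof (cases "{J \<in> K. dev J \<le> 0} = {}")
    case False
    obtain J0 where J0: "J0 \<in> K" "dev J0 \<le> 0"
      and min: "\<And>J. J \<in> K \<Longrightarrow> dev J \<le> 0 \<Longrightarrow> cond_div Q J0 \<le> cond_div Q J"
      using continuous_attains_inf[OF sub[OF cont(2), of 0] False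
          continuous_on_subset[OF cont(1), of "{J \<in> K. dev J \<le> 0}"]] by auto
    have "dev J0 = 0" using J0 by (intro antisym) (auto simp: dev_def sum_nonneg)
    then have *: "\<alpha> < cond_div Q J0" using J0 gt dev0 by (auto simp: K_def)
    show ?thesis
    proof (intro exI[of _ "(cond_div Q J0 - \<alpha>) / 2"] conjI ballI impI)
      fix J assume "J \<in> K" "dev J \<le> 0"
      then have "cond_div Q J0 \<le> cond_div Q J" by (rule min)
      then show "\<alpha> + (cond_div Q J0 - \<alpha>) / 2 < cond_div Q J" using * by argo
    qed (use * in simp)
  qed (auto intro!: exI[of _ 1])
  then obtain \<gamma> where \<gamma>: "\<gamma> > 0" "\<And>J. J \<in> K \<Longrightarrow> dev J \<le> 0 \<Longrightarrow> \<alpha> + \<gamma> < cond_div Q J"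
    by blast
  \<comment> \<open>The laws of divergence at most \<alpha> + \<gamma> form a compact set disjoint
    from the slice, so \<open>dev\<close> has a positive minimum on it.\<close>
  have "\<exists>r>0. \<forall>J\<in>K. dev J < r \<longrightarrow> \<alpha> + \<gamma> \<le> cond_div Q J"
  proof (cases "{J \<in> K. cond_div Q J \<le> \<alpha> + \<gamma>} = {}")
    case True
    then show ?thesis by (intro exI[of _ 1]) force
  next
    case False
    obtain J0 where J0: "J0 \<in> K" "cond_div Q J0 \<le> \<alpha> + \<gamma>"
      and min: "\<And>J. J \<in> K \<Longrightarrow> cond_div Q J \<le> \<alpha> + \<gamma> \<Longrightarrow> dev J0 \<le> dev J"
      using continuous_attains_inf[OF sub[OF cont(1), of "\<alpha> + \<gamma>"] False
          continuous_on_subset[OF cont(2), of "{J \<in> K. cond_div Q J \<le> \<alpha> + \<gamma>}"]] by auto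
    have "0 < dev J0" using J0 \<gamma>(2)[of J0] by force
    then show ?thesis using min by (intro exI[of _ "dev J0"]) force
  qed
  then obtain r where r: "r > 0" "\<And>J. J \<in> K \<Longrightarrow> dev J < r \<Longrightarrow> \<alpha> + \<gamma> \<le> cond_div Q J"
    by blast
  have "\<forall>J\<in>feasible Q \<inter> C. (\<forall>a. \<bar>marg_fst J a - pmf P a\<bar> < r / CARD('x)) \<longrightarrow>
      \<alpha> + \<gamma> \<le> cond_div Q J"
  proof (intro ballI impI)
    fix J assume J: "J \<in> feasible Q \<inter> C" "\<forall>a. \<bar>marg_fst J a - pmf P a\<bar> < r / CARD('x)"
    have "dev J < (\<Sum>a\<in>(UNIV::'x set). r / CARD('x))"
      unfolding dev_def using J by (intro sum_strict_mono) auto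
    then have "dev J < r" by simp
    then show "\<alpha> + \<gamma> \<le> cond_div Q J" using J r by (auto simp: K_def)
  qed
  moreover have "0 < r / CARD('x)" using r by simp
  ultimately show ?thesis using \<gamma>(1) by blast
qed

lemma marg_fst_emp: "marg_fst (emp_type x u i) a = real (cnt x i a) / real i"
  by (simp add: marg_fst_def emp_type_def sum_divide_distrib[symmetric] cnt_pair_fst flip: of_nat_sum)

lemma marg_snd_emp: "marg_snd (emp_type x u i) b = real (cnt u i b) / real i"
  by (simp add: marg_snd_def emp_type_def sum_divide_distrib[symmetric] cnt_pair_snd flip: of_nat_sum)

lemma cnt_pos_imp: "0 < cnt z i a \<Longrightarrow> \<exists>j\<in>{1..i}. z j = a"
  unfolding cnt_def by (metis (mono_tags, lifting) card.empty empty_Collect_eq less_irrefl)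

lemma emp_feasible:
  assumes "1 \<le> i" "\<And>j. j \<in> {1..i} \<Longrightarrow> pmf (Q (x j)) (u j) \<noteq> 0"
  shows "emp_type x u i \<in> feasible Q"
proof -
  have "(\<Sum>z\<in>UNIV. emp_type x u i $ z) = 1"
    using assms(1) cnt_sum[of "\<lambda>j. (x j, u j)" i]
    by (simp add: emp_type_def sum_divide_distrib[symmetric] flip: of_nat_sum)
  moreover have "emp_type x u i $ z = 0" if "pmf (Q (fst z)) (snd z) = 0" for z
    using that assms(2) cnt_pos_imp[of "\<lambda>j. (x j, u j)" i z] by (force simp: emp_type_def)
  ultimately show ?thesis by (auto simp: feasible_def emp_type_def)
qed

lemma prod_eq_exp_emp:
  fixes f :: "'x::finite \<times> 'y::finite \<Rightarrow> real"
  assumes "1 \<le> i" "\<And>j. j \<in> {1..i} \<Longrightarrow> 0 < f (x j, u j)"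
  shows "(\<Prod>j=1..i. f (x j, u j)) = exp (real i * (\<Sum>z\<in>UNIV. emp_type x u i $ z * ln (f z)))"
  using prod_eq_exp_cnt[of i f "\<lambda>j. (x j, u j)"] assms
  by (simp add: emp_type_def sum_distrib_left)

text \<open>The two products are exp(-i H(U|X)) and exp(-i H(X|U)) for the empirical law of the
  pair.\<close>

lemma cond_type_prod:
  fixes x :: "nat \<Rightarrow> 'x::finite" and u :: "nat \<Rightarrow> 'y::finite"
  assumes i: "1 \<le> i"
  shows "(\<Prod>j=1..i. real (cnt (\<lambda>j. (x j, u j)) i (x j, u j)) / real (cnt x i (x j)))
    = exp (real i * ((\<Sum>z\<in>UNIV. xlnx (emp_type x u i $ z)) - (\<Sum>a\<in>UNIV. xlnx (marg_fst (emp_type x u i) a))))"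
    (is "?L = exp (_ * ?R)")
    and "(\<Prod>j=1..i. real (cnt (\<lambda>j. (x j, u j)) i (x j, u j)) / real (cnt u i (u j)))
    = exp (real i * ((\<Sum>z\<in>UNIV. xlnx (emp_type x u i $ z)) - (\<Sum>b\<in>UNIV. xlnx (marg_snd (emp_type x u i) b))))"
    (is "?L' = exp (_ * ?R')")
proof -
  have pos: "0 < cnt (\<lambda>j. (x j, u j)) i (x j, u j)" "0 < cnt x i (x j)" "0 < cnt u i (u j)"
    if "j \<in> {1..i}" for j
    using that cnt_pos[of j i "\<lambda>j. (x j, u j)"] by (auto simp: cnt_pos)
  have "?L = exp (real i * (\<Sum>z\<in>UNIV. emp_type x u i $ z *
      ln (real (cnt (\<lambda>j. (x j, u j)) i z) / real (cnt x i (fst z)))))"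
    using pos i
    by (subst prod_eq_exp_emp[symmetric]) auto
  also have "(\<Sum>z\<in>UNIV. emp_type x u i $ z * ln (real (cnt (\<lambda>j. (x j, u j)) i z) / real (cnt x i (fst z))))
    = (\<Sum>z\<in>UNIV. emp_type x u i $ z * ln (emp_type x u i $ z / (\<Sum>b\<in>UNIV. emp_type x u i $ (fst z, b))))"
    using i by (simp add: marg_fst_emp[unfolded marg_fst_def]) (simp add: emp_type_def)
  also have "\<dots> = ?R" unfolding marg_fst_def by (rule sum_ln_ratio_fst) (simp add: emp_type_def)
  finally show "?L = exp (real i * ?R)" .
  have "?L' = exp (real i * (\<Sum>z\<in>UNIV. emp_type x u i $ z *
      ln (real (cnt (\<lambda>j. (x j, u j)) i z) / real (cnt u i (snd z)))))"
    using pos i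
    by (subst prod_eq_exp_emp[symmetric]) auto
  also have "(\<Sum>z\<in>UNIV. emp_type x u i $ z * ln (real (cnt (\<lambda>j. (x j, u j)) i z) / real (cnt u i (snd z))))
    = (\<Sum>z\<in>UNIV. emp_type x u i $ z * ln (emp_type x u i $ z / (\<Sum>a\<in>UNIV. emp_type x u i $ (a, snd z))))"
    using i by (simp add: marg_snd_emp[unfolded marg_snd_def]) (simp add: emp_type_def)
  also have "\<dots> = ?R'" unfolding marg_snd_def by (rule sum_ln_ratio_snd) (simp add: emp_type_def)
  finally show "?L' = exp (real i * ?R')" .
qed

text \<open>The likelihood of \<open>u\<close> is exp(-i D) times its product of empirical
  conditional probabilities, with D the \<open>cond_div\<close> of the empirical law; those products
  are the kernels of the change of measure. Infeasible types have likelihood zero, so the exponent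
  is asked of feasible laws only.\<close>

lemma sanov_bound:
  fixes Q :: "'x::finite \<Rightarrow> 'y::finite pmf"
  assumes i: "1 \<le> i"
    and E: "\<And>u. emp_type x u i \<in> feasible Q \<Longrightarrow> emp_type x u i \<in> C \<Longrightarrow> E \<le> cond_div Q (emp_type x u i)"
  shows "(\<Sum>u\<in>{u\<in>seqs i. emp_type x u i \<in> C}. \<Prod>j=1..i. pmf (Q (x j)) (u j))
    \<le> real ((i + 1) ^ CARD('x \<times> 'y)) * exp (- (real i * E))"
proof -
  define g where "g = (\<lambda>(t :: 'x \<times> 'y \<Rightarrow> nat) j b. real (t (x j, b)) / real (\<Sum>b\<in>UNIV. t (x j, b)))"
  have "(\<Sum>u\<in>{u\<in>seqs i. emp_type x u i \<in> C}. \<Prod>j=1..i. pmf (Q (x j)) (u j))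
    \<le> real (card (types i :: ('x \<times> 'y \<Rightarrow> nat) set)) * exp (- (real i * E))"
  proof (rule sum_le_by_types[where ty = "\<lambda>u. cnt (\<lambda>j. (x j, u j)) i"
        and g = "\<lambda>t u. \<Prod>j=1..i. g t j (u j)"])
    fix u assume u: "u \<in> {u\<in>seqs i. emp_type x u i \<in> C}"
    let ?t = "cnt (\<lambda>j. (x j, u j)) i"
    have g: "(\<Prod>j=1..i. g ?t j (u j)) = (\<Prod>j=1..i. real (?t (x j, u j)) / real (cnt x i (x j)))"
      by (intro prod.cong refl) (simp add: g_def cnt_pair_fst del: of_nat_sum)
    have "(\<Prod>j=1..i. pmf (Q (x j)) (u j)) \<le> exp (- (real i * E)) * (\<Prod>j=1..i. g ?t j (u j))"
    proof (cases "\<forall>j\<in>{1..i}. pmf (Q (x j)) (u j) \<noteq> 0")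
      case True
      then have "emp_type x u i \<in> feasible Q" using i by (intro emp_feasible) auto
      then have "real i * E \<le> real i * cond_div Q (emp_type x u i)"
        using E u by (intro mult_left_mono) auto
      moreover have "(\<Prod>j=1..i. pmf (Q (x j)) (u j)) =
          exp (real i * (\<Sum>z\<in>UNIV. emp_type x u i $ z * ln (pmf (Q (fst z)) (snd z))))"
        using True i by (subst prod_eq_exp_emp[symmetric]) (auto simp: pmf_pos)
      ultimately show ?thesis
        unfolding g cond_type_prod(1)[OF i] by (simp add: cond_div_def exp_add[symmetric] algebra_simps)
    next
      case False
      then have "(\<Prod>j=1..i. pmf (Q (x j)) (u j)) = 0" by (intro prod_zero) auto
      moreover have "0 \<le> (\<Prod>j=1..i. g ?t j (u j))"
        by (intro prod_nonneg) (simp add: g_def sum_nonneg)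
      ultimately show ?thesis by (metis exp_ge_zero mult_nonneg_nonneg)
    qed
    then show "?t \<in> types i \<and> (\<Prod>j=1..i. pmf (Q (x j)) (u j)) \<le> exp (- (real i * E)) * (\<Prod>j=1..i. g ?t j (u j))"
      by (simp add: cnt_in_types)
  next
    fix t :: "'x \<times> 'y \<Rightarrow> nat"
    have "(\<Sum>b\<in>UNIV. g t j b) \<le> 1" for j
      unfolding g_def by (rule sum_ratio_le_1)
    then show "(\<Sum>u\<in>{u\<in>seqs i. emp_type x u i \<in> C}. \<Prod>j=1..i. g t j (u j)) \<le> 1"
      by (intro sum_kernel_le_1) (auto simp: g_def sum_nonneg)
  qed (auto intro!: prod_nonneg simp: g_def sum_nonneg)
  then show ?thesis by (simp add: card_types)
qed

section \<open>Missed detections\<close>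

definition info_div :: "'x::finite pmf \<Rightarrow> real^('x \<times> 'y::finite) \<Rightarrow> real" where
  "info_div P J = (\<Sum>z\<in>UNIV. xlnx (J $ z)) - (\<Sum>b\<in>UNIV. xlnx (marg_snd J b))
     - (\<Sum>a\<in>UNIV. marg_fst J a * ln (pmf P a))"

definition noise_div :: "'y::finite pmf \<Rightarrow> real^('x::finite \<times> 'y) \<Rightarrow> real" where
  "noise_div W J = (\<Sum>b\<in>UNIV. xlnx (marg_snd J b)) - (\<Sum>b\<in>UNIV. marg_snd J b * ln (pmf W b))"

text \<open>An output law charging a letter that noise never produces has infinite divergence from
  noise and passes the noise test; hence the support clause, without which \<open>noise_div\<close>
  is not a divergence. Non-strict inequalities keep the set closed.\<close>

definition miss_set :: "'x::finite pmf \<Rightarrow> 'y::finite pmf \<Rightarrow> real \<Rightarrow> real \<Rightarrow> (real^('x \<times> 'y)) set" where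
  "miss_set P W r1 r2 = {J. (\<forall>z. 0 \<le> J $ z) \<and>
     (info_div P J \<le> r2 \<or> (\<forall>b. pmf W b = 0 \<longrightarrow> marg_snd J b = 0) \<and> noise_div W J \<le> r1)}"

lemma closed_miss_set: "closed (miss_set P W r1 r2)"
proof -
  define S :: "(real^('a \<times> 'b)) set" where "S = {J. \<forall>z. 0 \<le> J $ z}"
  have S: "closed S"
    unfolding S_def by (intro closed_Collect_all closed_Collect_le continuous_intros)
  have nn: "0 \<le> marg_snd J b" if "J \<in> S" for J b
    using that by (auto simp: S_def marg_snd_def intro: sum_nonneg)
  have Snn: "0 \<le> J $ z" if "J \<in> S" for J z using that unfolding S_def by blast
  have i: "continuous_on S (info_div P)"
    unfolding info_div_def[abs_def] by (intro continuous_intros) (auto simp: nn Snn simp del: split_paired_All)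
  have n: "continuous_on S (noise_div W)"
    unfolding noise_div_def[abs_def] by (intro continuous_intros) (auto simp: nn)
  have ci: "closed (S \<inter> info_div P -` {..r2})" and cn: "closed (S \<inter> noise_div W -` {..r1})"
    by (auto intro!: continuous_closed_preimage i n S)
  have cm: "closed {J :: real^('a \<times> 'b). \<forall>b. pmf W b = 0 \<longrightarrow> marg_snd J b = 0}"
    by (intro closed_Collect_all closed_Collect_imp open_Collect_const closed_Collect_eq continuous_intros)
  have "closed ((S \<inter> info_div P -` {..r2}) \<union>
      (S \<inter> noise_div W -` {..r1} \<inter> {J. \<forall>b. pmf W b = 0 \<longrightarrow> marg_snd J b = 0}))"
    by (rule closed_Un[OF ci closed_Int[OF cn cm]])
  moreover have "(S \<inter> info_div P -` {..r2}) \<union>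
      (S \<inter> noise_div W -` {..r1} \<inter> {J. \<forall>b. pmf W b = 0 \<longrightarrow> marg_snd J b = 0}) = miss_set P W r1 r2"
    by (auto simp: miss_set_def S_def)
  ultimately show ?thesis by simp
qed

lemma failed_test_in_miss_set:
  fixes x :: "nat \<Rightarrow> 'x::finite" and u :: "nat \<Rightarrow> 'y::finite"
  assumes i: "1 \<le> i" and P: "\<And>j. j \<in> {1..i} \<Longrightarrow> pmf P (x j) \<noteq> 0"
    and L: "L1 \<le> real i * r1" "L2 \<le> real i * r2"
    and fail: "\<not> (noise_test W L1 i u \<and> codeword_test P L2 i x u)"
  shows "emp_type x u i \<in> miss_set P W r1 r2"
proof (cases "codeword_test P L2 i x u")
  case False
  have "(\<Prod>j=1..i. pmf P (x j)) = exp (real i * (\<Sum>z\<in>UNIV. emp_type x u i $ z * ln (pmf P (fst z))))"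
    using P i by (subst prod_eq_exp_emp[symmetric]) (auto simp: pmf_pos)
  also have "(\<Sum>z\<in>UNIV. emp_type x u i $ z * ln (pmf P (fst z))) = (\<Sum>a\<in>UNIV. marg_fst (emp_type x u i) a * ln (pmf P a))"
    by (simp add: sum_UNIV_pair marg_fst_def sum_distrib_right)
  finally have "real i * ((\<Sum>z\<in>UNIV. xlnx (emp_type x u i $ z)) - (\<Sum>b\<in>UNIV. xlnx (marg_snd (emp_type x u i) b)))
      < L2 + real i * (\<Sum>a\<in>UNIV. marg_fst (emp_type x u i) a * ln (pmf P a))"
    using False unfolding codeword_test_def cond_type_prod(2)[OF i] by (simp add: exp_add[symmetric] not_le)
  then have "real i * info_div P (emp_type x u i) < real i * r2"
    using L unfolding info_div_def by (simp add: right_diff_distrib)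
  then have "info_div P (emp_type x u i) \<le> r2" using i by simp
  then show ?thesis by (simp add: miss_set_def emp_type_def)
next
  case True
  have g: "0 < real (cnt u i (u j)) / real i" if "j \<in> {1..i}" for j
    using that cnt_pos[of j i u] by auto
  have eq: "(\<Prod>j=1..i. real (cnt u i (u j)) / real i) = exp (real i * (\<Sum>b\<in>UNIV. xlnx (marg_snd (emp_type x u i) b)))"
    using prod_eq_exp_cnt[where f = "\<lambda>b. real (cnt u i b) / real i" and z = u, OF g] i
    by (simp add: marg_snd_emp xlnx_def sum_distrib_left)
  have lt: "(\<Prod>j=1..i. real (cnt u i (u j)) / real i) < exp L1 * (\<Prod>j=1..i. pmf W (u j))"
    using True fail by (simp add: noise_test_def)
  \<comment> \<open>With noise likelihood zero the test would have been passed; its failure thus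
    yields the support clause.\<close>
  then have "(\<Prod>j=1..i. pmf W (u j)) \<noteq> 0"
    unfolding eq by (metis exp_gt_zero mult_zero_right not_less_iff_gr_or_eq)
  then have W: "pmf W (u j) \<noteq> 0" if "j \<in> {1..i}" for j
    using that by (auto simp: prod_zero_iff)
  have W0: "marg_snd (emp_type x u i) b = 0" if "pmf W b = 0" for b
    using that W cnt_pos_imp[of u i b] unfolding marg_snd_emp by force
  have "(\<Prod>j=1..i. pmf W (u j)) = exp (real i * (\<Sum>b\<in>UNIV. marg_snd (emp_type x u i) b * ln (pmf W b)))"
    using prod_eq_exp_cnt[of i "pmf W" u] W i
    by (simp add: marg_snd_emp sum_distrib_left pmf_pos)
  then have "real i * (\<Sum>b\<in>UNIV. xlnx (marg_snd (emp_type x u i) b))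
      < L1 + real i * (\<Sum>b\<in>UNIV. marg_snd (emp_type x u i) b * ln (pmf W b))"
    using lt unfolding eq by (simp add: exp_add[symmetric])
  then have "real i * noise_div W (emp_type x u i) < real i * r1"
    using L unfolding noise_div_def by (simp add: right_diff_distrib)
  then have "noise_div W (emp_type x u i) \<le> r1" using i by simp
  then show ?thesis using W0 by (auto simp: miss_set_def emp_type_def)
qed

definition near_type :: "'x pmf \<Rightarrow> real \<Rightarrow> nat \<Rightarrow> (nat \<Rightarrow> 'x) \<Rightarrow> bool" where
  "near_type P \<eta> i x \<longleftrightarrow> (\<forall>a. \<bar>real (cnt x i a) / real i - pmf P a\<bar> < \<eta>)"

text \<open>The hypothesis concerns input marginals exactly equal to \<open>P\<close>, which
  empirical types rarely are; the gap extends it to nearby types. \<open>\<eta>\<close> and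
  \<open>\<gamma>\<close> depend neither on the length nor on the codeword or the
  thresholds.\<close>

lemma miss_bound:
  fixes Q :: "'x::finite \<Rightarrow> 'y::finite pmf"
  assumes gap: "\<And>J. J \<in> feasible Q \<Longrightarrow> J \<in> miss_set P W r1 r2 \<Longrightarrow> marg_fst J = pmf P \<Longrightarrow> \<alpha> < cond_div Q J"
  shows "\<exists>\<eta>>0. \<exists>\<gamma>>0. \<forall>i x L1 L2. 1 \<le> i \<longrightarrow> (\<forall>j\<in>{1..i}. pmf P (x j) \<noteq> 0) \<longrightarrow> near_type P \<eta> i x \<longrightarrow>
     L1 \<le> real i * r1 \<longrightarrow> L2 \<le> real i * r2 \<longrightarrow>
     (\<Sum>u\<in>{u\<in>seqs i. \<not> (noise_test W L1 i u \<and> codeword_test P L2 i x u)}. \<Prod>j=1..i. pmf (Q (x j)) (u j))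
       \<le> real ((i + 1) ^ CARD('x \<times> 'y)) * exp (- (real i * (\<alpha> + \<gamma>)))"
proof -
  have "\<exists>\<eta>>0. \<exists>\<gamma>>0. \<forall>J\<in>feasible Q \<inter> miss_set P W r1 r2.
      (\<forall>a. \<bar>marg_fst J a - pmf P a\<bar> < \<eta>) \<longrightarrow> \<alpha> + \<gamma> \<le> cond_div Q J"
    by (rule cond_div_gap[OF closed_miss_set]) (rule gap)
  then obtain \<eta> \<gamma> where *: "\<eta> > 0" "\<gamma> > 0" "\<forall>J\<in>feasible Q \<inter> miss_set P W r1 r2.
      (\<forall>a. \<bar>marg_fst J a - pmf P a\<bar> < \<eta>) \<longrightarrow> \<alpha> + \<gamma> \<le> cond_div Q J" by (elim exE conjE)
  have "(\<Sum>u\<in>{u\<in>seqs i. \<not> (noise_test W L1 i u \<and> codeword_test P L2 i x u)}. \<Prod>j=1..i. pmf (Q (x j)) (u j))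
       \<le> real ((i + 1) ^ CARD('x \<times> 'y)) * exp (- (real i * (\<alpha> + \<gamma>)))"
    if "1 \<le> i" "\<forall>j\<in>{1..i}. pmf P (x j) \<noteq> 0" "near_type P \<eta> i x" "L1 \<le> real i * r1" "L2 \<le> real i * r2"
    for i x L1 L2
  proof -
    have "(\<Sum>u\<in>{u\<in>seqs i. \<not> (noise_test W L1 i u \<and> codeword_test P L2 i x u)}. \<Prod>j=1..i. pmf (Q (x j)) (u j))
       \<le> (\<Sum>u\<in>{u\<in>seqs i. emp_type x u i \<in> miss_set P W r1 r2}. \<Prod>j=1..i. pmf (Q (x j)) (u j))"
      using failed_test_in_miss_set[of i P x L1 r1 L2 r2 W] that
      by (intro sum_mono2) (auto intro!: prod_nonneg)
    also have "\<dots> \<le> real ((i + 1) ^ CARD('x \<times> 'y)) * exp (- (real i * (\<alpha> + \<gamma>)))"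
      by (rule sanov_bound) (use that * in \<open>auto simp: marg_fst_emp near_type_def\<close>)
    finally show ?thesis .
  qed
  then show ?thesis using *(1,2) by (intro exI[of _ \<eta>] exI[of _ \<gamma>] conjI) simp_all
qed

text \<open>The conditional Sanov bound with a one-letter input alphabet and a channel that always
  outputs \<open>P\<close>: the codeword plays the role of the output. The exponent is positive
  because zero divergence forces the law \<open>P\<close>.\<close>

lemma atypical_bound:
  fixes P :: "'x::finite pmf"
  assumes "0 < \<eta>"
  shows "\<exists>\<gamma>>0. \<forall>i\<ge>1. (\<Sum>x\<in>{x\<in>seqs i. \<not> near_type P \<eta> i x}. \<Prod>j=1..i. pmf P (x j))
     \<le> real ((i + 1) ^ CARD('x)) * exp (- (real i * \<gamma>))"
proof -
  define C where "C = {J :: real^(unit \<times> 'x). \<exists>a. \<eta> \<le> \<bar>marg_snd J a - pmf P a\<bar>}"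
  have "closed C"
  proof -
    have "C = (\<Union>a\<in>UNIV. {J. \<eta> \<le> \<bar>marg_snd J a - pmf P a\<bar>})" by (auto simp: C_def)
    then show ?thesis by (auto intro!: closed_UN closed_Collect_le continuous_intros)
  qed
  moreover have "0 < cond_div (\<lambda>_. P) J"
    if J: "J \<in> feasible (\<lambda>_. P)" "J \<in> C" "marg_fst J = pmf (return_pmf ())" for J
  proof (rule ccontr)
    have m: "marg_snd J b = J $ ((), b)" for b by (simp add: marg_snd_def UNIV_unit)
    have 1: "(\<Sum>b\<in>UNIV. J $ ((), b)) = 1" "\<And>b. 0 \<le> J $ ((), b)"
      "\<And>b. pmf P b = 0 \<Longrightarrow> J $ ((), b) = 0"
      using J(1) by (auto simp: feasible_def sum_UNIV_pair UNIV_unit)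
    assume "\<not> 0 < cond_div (\<lambda>_. P) J"
    moreover have "cond_div (\<lambda>_. P) J = (\<Sum>b\<in>UNIV. J $ ((), b) * ln (J $ ((), b) / pmf P b))"
    proof -
      have "J $ ((), b) * ln (J $ ((), b) / pmf P b) = xlnx (J $ ((), b)) - J $ ((), b) * ln (pmf P b)" for b
        using 1(3)[of b] 1(2)[of b] pmf_nonneg[of P b]
        by (cases "J $ ((), b) = 0"; cases "pmf P b = 0") (auto simp: xlnx_def ln_div right_diff_distrib)
      then show ?thesis
        by (simp add: cond_div_def sum_UNIV_pair UNIV_unit J(3) xlnx_def sum_subtractf)
    qed
    ultimately have "(\<lambda>b. J $ ((), b)) = pmf P"
      by (intro gibbs(2)) (auto simp: 1 sum_pmf_eq_1)
    then have "J $ ((), b) = pmf P b" for b by metis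
    then show False using J(2) assms by (auto simp: C_def m)
  qed
  ultimately have "\<exists>\<eta>'>0. \<exists>\<gamma>>0. \<forall>J\<in>feasible (\<lambda>_. P) \<inter> C.
      (\<forall>a. \<bar>marg_fst J a - pmf (return_pmf ()) a\<bar> < \<eta>') \<longrightarrow> 0 + \<gamma> \<le> cond_div (\<lambda>_. P) J"
    by (intro cond_div_gap) auto
  then obtain \<eta>' \<gamma> where *: "\<eta>' > 0" "\<gamma> > 0" "\<forall>J\<in>feasible (\<lambda>_. P) \<inter> C.
      (\<forall>a. \<bar>marg_fst J a - pmf (return_pmf ()) a\<bar> < \<eta>') \<longrightarrow> 0 + \<gamma> \<le> cond_div (\<lambda>_. P) J"
    by (elim exE conjE)
  show ?thesis
  proof (intro exI[of _ \<gamma>] conjI allI impI)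
    fix i :: nat assume i: "1 \<le> i"
    have c: "cnt (\<lambda>_. ()) i () = i" using cnt_sum[of "\<lambda>_. ()" i] by (simp add: UNIV_unit)
    have "(\<Sum>x\<in>{x\<in>seqs i. emp_type (\<lambda>_. ()) x i \<in> C}. \<Prod>j=1..i. pmf P (x j))
      \<le> real ((i + 1) ^ CARD(unit \<times> 'x)) * exp (- (real i * \<gamma>))"
      by (rule sanov_bound) (use i * in \<open>auto simp: marg_fst_emp c\<close>)
    moreover have "emp_type (\<lambda>_. ()) x i \<in> C \<longleftrightarrow> \<not> near_type P \<eta> i x" for x
      by (auto simp: C_def near_type_def marg_snd_emp not_less)
    ultimately show "(\<Sum>x\<in>{x\<in>seqs i. \<not> near_type P \<eta> i x}. \<Prod>j=1..i. pmf P (x j))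
     \<le> real ((i + 1) ^ CARD('x)) * exp (- (real i * \<gamma>))" by simp
  qed (use * in simp)
qed

section \<open>From joint types to channels\<close>

lemma pmf_joint:
  fixes P :: "'x::finite pmf" and V :: "'x \<Rightarrow> 'y::finite pmf"
  shows "pmf (joint P V) (a, b) = pmf P a * pmf (V a) b"
proof -
  have "pmf (joint P V) (a, b) = (\<Sum>x\<in>UNIV. pmf (map_pmf (Pair x) (V x)) (a, b) * pmf P x)"
    unfolding joint_def pmf_bind by (subst integral_measure_pmf_real[of UNIV]) auto
  also have "\<dots> = (\<Sum>x\<in>UNIV. if x = a then pmf (V a) b * pmf P a else 0)"
  proof (intro sum.cong refl)
    fix x
    show "pmf (map_pmf (Pair x) (V x)) (a, b) * pmf P x = (if x = a then pmf (V a) b * pmf P a else 0)"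
    proof (cases "x = a")
      case True
      then show ?thesis by (simp add: pmf_map_inj' inj_on_def)
    next
      case False
      then have "pmf (map_pmf (Pair x) (V x)) (a, b) = 0" by (auto simp: pmf_eq_0_set_pmf)
      then show ?thesis using False by simp
    qed
  qed
  finally show ?thesis by simp
qed

lemma map_fst_joint: "map_pmf fst (joint P V) = P"
  by (simp add: joint_def map_bind_pmf pmf.map_comp o_def bind_return_pmf')

lemma pmf_out_marg:
  fixes P :: "'x::finite pmf" and V :: "'x \<Rightarrow> 'y::finite pmf"
  shows "pmf (out_marg P V) b = (\<Sum>a\<in>UNIV. pmf P a * pmf (V a) b)"
proof -
  have "pmf (out_marg P V) b = (\<Sum>z\<in>snd -` {b}. pmf (joint P V) z)"
    unfolding out_marg_def pmf_map by (rule measure_measure_pmf_finite) simp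
  also have "snd -` {b} = (\<lambda>a. (a, b)) ` UNIV" by auto
  finally show ?thesis by (simp add: sum.reindex inj_on_def pmf_joint)
qed

lemma KL_eq:
  fixes p q :: "'a::finite pmf"
  assumes "\<And>a. pmf q a = 0 \<Longrightarrow> pmf p a = 0"
  shows "KL p q = ereal (\<Sum>a\<in>UNIV. pmf p a * ln (pmf p a / pmf q a))"
proof -
  have "(\<Sum>a | pmf p a > 0. pmf p a * ln (pmf p a / pmf q a)) = (\<Sum>a\<in>UNIV. pmf p a * ln (pmf p a / pmf q a))"
    by (rule sum.mono_neutral_left) (auto simp: not_less)
  moreover have "\<not> (\<exists>a. pmf p a > 0 \<and> pmf q a = 0)"
    using assms by (metis less_irrefl)
  ultimately show ?thesis by (simp add: KL_def)
qed

lemma mult_ln_ratio: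
  assumes "0 \<le> p" "0 \<le> q" "q = 0 \<Longrightarrow> p = 0"
  shows "p * ln (p / q) = xlnx p - p * ln q"
proof (cases "p = 0")
  case False
  then have "0 < p" "0 < q" using assms by linarith+
  then show ?thesis by (simp add: xlnx_def ln_div right_diff_distrib)
qed (simp add: xlnx_def)

text \<open>The difference of the two divergences is D(p || q'), where \<open>q'\<close> has the
  second marginal of \<open>p\<close> and the conditional law of \<open>q\<close>; it is nonnegative
  by \<open>gibbs\<close>.\<close>

lemma data_processing:
  fixes p q :: "'x::finite \<times> 'y::finite \<Rightarrow> real"
  assumes p: "\<And>z. 0 \<le> p z" "(\<Sum>z\<in>UNIV. p z) = 1" and q: "\<And>z. 0 \<le> q z"
    and ac: "\<And>z. q z = 0 \<Longrightarrow> p z = 0"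
  defines "m \<equiv> \<lambda>b. \<Sum>a\<in>UNIV. p (a, b)" and "l \<equiv> \<lambda>b. \<Sum>a\<in>UNIV. q (a, b)"
  shows "(\<Sum>b\<in>UNIV. m b * ln (m b / l b)) \<le> (\<Sum>z\<in>UNIV. p z * ln (p z / q z))"
proof -
  define q' where "q' = (\<lambda>z. q z * m (snd z) / l (snd z))"
  have pm: "p (a, b) \<le> m b" and ql: "q (a, b) \<le> l b" for a b
    unfolding m_def l_def using p q
    by (auto intro!: member_le_sum[of a UNIV "\<lambda>a. p (a, b)"] member_le_sum[of a UNIV "\<lambda>a. q (a, b)"])
  have m0: "0 \<le> m b" and l0: "0 \<le> l b" for b using p q by (auto simp: m_def l_def intro: sum_nonneg)
  have m1: "(\<Sum>b\<in>UNIV. m b) = 1"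
    unfolding m_def using p(2) by (subst sum.swap) (simp add: sum_UNIV_pair)
  have pos: "0 < q (a, b) \<and> 0 < m b \<and> 0 < l b" if "p (a, b) \<noteq> 0" for a b
  proof -
    have "0 < p (a, b)" using that p(1)[of "(a, b)"] by linarith
    moreover have "0 < q (a, b)" using that ac[of "(a, b)"] q[of "(a, b)"] by fastforce
    ultimately show ?thesis using pm[of a b] ql[of a b] by linarith
  qed
  have "0 \<le> (\<Sum>z\<in>UNIV. p z * ln (p z / q' z))"
  proof (rule gibbs(1))
    have "(\<Sum>z\<in>UNIV. q' z) = (\<Sum>b\<in>UNIV. l b * (m b / l b))"
      unfolding sum_UNIV_pair q'_def l_def sum_distrib_right by (subst sum.swap) simp
    also have "\<dots> \<le> (\<Sum>b\<in>UNIV. m b)" by (intro sum_mono) (use m0 in auto)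
    finally show "(\<Sum>z\<in>UNIV. q' z) \<le> 1" using m1 by simp
    show "p z = 0" if "q' z = 0" for z
      by (rule ccontr) (use that pos[of "fst z" "snd z"] in \<open>auto simp: q'_def\<close>)
  qed (use p q m0 l0 in \<open>auto simp: q'_def\<close>)
  also have "(\<Sum>z\<in>UNIV. p z * ln (p z / q' z)) =
      (\<Sum>z\<in>UNIV. p z * ln (p z / q z) - p z * ln (m (snd z) / l (snd z)))"
  proof (intro sum.cong refl)
    fix z :: "'x \<times> 'y"
    show "p z * ln (p z / q' z) = p z * ln (p z / q z) - p z * ln (m (snd z) / l (snd z))"
    proof (cases "p z = 0")
      case False
      then have *: "0 < p z" "0 < q z" "0 < m (snd z)" "0 < l (snd z)"
        using pos[of "fst z" "snd z"] p(1)[of z] by auto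
      then show ?thesis by (simp add: q'_def ln_div ln_mult algebra_simps)
    qed simp
  qed
  also have "\<dots> = (\<Sum>z\<in>UNIV. p z * ln (p z / q z)) - (\<Sum>b\<in>UNIV. m b * ln (m b / l b))"
  proof -
    have "(\<Sum>z\<in>UNIV. p z * ln (m (snd z) / l (snd z))) = (\<Sum>b\<in>UNIV. m b * ln (m b / l b))"
      unfolding sum_UNIV_pair by (subst sum.swap) (simp add: m_def sum_distrib_right)
    then show ?thesis by (simp add: sum_subtractf)
  qed
  finally show ?thesis by simp
qed

lemma feasible_joint:
  fixes Q :: "'x::finite \<Rightarrow> 'y::finite pmf"
  assumes J: "J \<in> feasible Q" and P: "marg_fst J = pmf P"
  obtains V where "\<And>z. pmf (joint P V) z = J $ z"
proof -
  \<comment> \<open>Where \<open>P\<close> vanishes every kernel gives the same joint law;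
    \<open>Q a\<close> is a filler.\<close>
  define V where "V a = (if pmf P a = 0 then Q a else embed_pmf (\<lambda>b. J $ (a, b) / pmf P a))" for a
  have s: "(\<Sum>b\<in>UNIV. J $ (a, b)) = pmf P a" for a using P by (metis marg_fst_def)
  have V: "pmf (V a) b = J $ (a, b) / pmf P a" if "pmf P a \<noteq> 0" for a b
  proof -
    have nn: "0 \<le> J $ (a, b) / pmf P a" for b using feasible_nonneg[OF J] by simp
    have "(\<integral>\<^sup>+ b. ennreal (J $ (a, b) / pmf P a) \<partial>count_space UNIV) = ennreal (\<Sum>b\<in>UNIV. J $ (a, b) / pmf P a)"
      using nn by (subst nn_integral_count_space_finite) (auto simp: sum_ennreal)
    also have "(\<Sum>b\<in>UNIV. J $ (a, b) / pmf P a) = 1"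
      using that by (simp add: sum_divide_distrib[symmetric] s)
    finally have "pmf (embed_pmf (\<lambda>b. J $ (a, b) / pmf P a)) b = J $ (a, b) / pmf P a"
      using nn by (intro pmf_embed_pmf) auto
    then show ?thesis using that by (simp add: V_def)
  qed
  have "pmf (joint P V) (a, b) = J $ (a, b)" for a b
  proof (cases "pmf P a = 0")
    case True
    moreover have "J $ (a, b) \<le> pmf P a"
      unfolding s[symmetric] using feasible_nonneg[OF J] by (intro member_le_sum) auto
    ultimately have "J $ (a, b) = 0" using feasible_nonneg[OF J, of "(a, b)"] by linarith
    then show ?thesis using True by (simp add: pmf_joint)
  qed (simp add: pmf_joint V)
  then show thesis using that[of V] by auto
qed

text \<open>The dictionary between continuous functions of \<open>J\<close> and the quantities in
  (a), (b), (c). The equality case at zero divergence serves the short window, where only a positive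
  exponent is wanted.\<close>

lemma divergences_of_joint:
  fixes Q :: "'x::finite \<Rightarrow> 'y::finite pmf"
  assumes J: "J \<in> feasible Q" and V: "\<And>z. pmf (joint P V) z = J $ z"
  shows "marg_fst J = pmf P"
    and "pmf (out_marg P V) b = marg_snd J b"
    and "KL (joint P V) (joint P Q) = ereal (cond_div Q J)"
    and "mutual_info (joint P V) = info_div P J"
    and "KL (out_marg P V) (out_marg P Q) \<le> ereal (cond_div Q J)"
    and "(\<And>b. pmf W b = 0 \<Longrightarrow> marg_snd J b = 0) \<Longrightarrow> KL (out_marg P V) W = ereal (noise_div W J)"
    and "cond_div Q J \<le> 0 \<Longrightarrow> joint P V = joint P Q"
proof -
  have J': "J $ (a, b) = pmf P a * pmf (V a) b" for a b
    using V[of "(a, b)"] by (simp add: pmf_joint)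
  have nn: "0 \<le> J $ z" for z using J by (rule feasible_nonneg)
  have one: "(\<Sum>z\<in>UNIV. J $ z) = 1" using J by (auto simp: feasible_def)
  show mf: "marg_fst J = pmf P"
    by (rule ext) (simp add: marg_fst_def J' sum_distrib_left[symmetric] sum_pmf_eq_1)
  show ms: "pmf (out_marg P V) b = marg_snd J b" for b
    by (simp add: marg_snd_def J' pmf_out_marg)
  have ac: "pmf (joint P V) z = 0" if "pmf (joint P Q) z = 0" for z
    using that J by (cases z) (auto simp: V pmf_joint feasible_def J'[symmetric], auto simp: J')
  have cd: "cond_div Q J = (\<Sum>z\<in>UNIV. pmf (joint P V) z * ln (pmf (joint P V) z / pmf (joint P Q) z))"
  proof -
    have "pmf (joint P V) z * ln (pmf (joint P V) z / pmf (joint P Q) z) =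
        xlnx (J $ z) - J $ z * ln (pmf P (fst z)) - J $ z * ln (pmf (Q (fst z)) (snd z))" for z
    proof (cases "J $ z = 0")
      case False
      then have "pmf (joint P Q) z \<noteq> 0" using ac[of z] V[of z] by auto
      then have "0 < pmf P (fst z)" "0 < pmf (Q (fst z)) (snd z)"
        by (cases z; auto simp: pmf_joint pmf_pos)+
      moreover have "pmf (joint P Q) z = pmf P (fst z) * pmf (Q (fst z)) (snd z)"
        by (cases z) (simp add: pmf_joint)
      moreover have "0 < J $ z" using False nn[of z] by linarith
      ultimately show ?thesis by (simp add: V xlnx_def ln_div ln_mult algebra_simps)
    qed (simp add: V xlnx_def)
    moreover have "(\<Sum>z\<in>UNIV. J $ z * ln (pmf P (fst z))) = (\<Sum>a\<in>UNIV. xlnx (marg_fst J a))"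
      by (simp add: sum_UNIV_pair sum_distrib_right[symmetric] xlnx_def mf marg_fst_def[symmetric])
    ultimately show ?thesis by (simp add: cond_div_def sum_subtractf)
  qed
  show "KL (joint P V) (joint P Q) = ereal (cond_div Q J)"
    unfolding cd by (rule KL_eq) (rule ac)
  show "joint P V = joint P Q" if "cond_div Q J \<le> 0"
  proof -
    have "pmf (joint P V) = pmf (joint P Q)"
      by (rule gibbs(2)) (use that ac in \<open>auto simp: sum_pmf_eq_1 cd\<close>)
    then show ?thesis by (intro pmf_eqI) simp
  qed
  have "(\<Sum>b\<in>UNIV. pmf (out_marg P V) b * ln (pmf (out_marg P V) b / pmf (out_marg P Q) b)) \<le> cond_div Q J"
    unfolding cd
    using data_processing[of "pmf (joint P V)" "pmf (joint P Q)"] ac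
    by (simp add: sum_pmf_eq_1 pmf_joint pmf_out_marg)
  moreover have "pmf (out_marg P V) b = 0" if "pmf (out_marg P Q) b = 0" for b
  proof -
    have "pmf (joint P Q) (a, b) = 0" for a
      using that unfolding pmf_out_marg by (subst (asm) sum_nonneg_eq_0_iff) (auto simp: pmf_joint)
    then have "pmf (joint P V) (a, b) = 0" for a using ac by blast
    then show ?thesis unfolding pmf_out_marg pmf_joint by (intro sum.neutral) blast
  qed
  ultimately show "KL (out_marg P V) (out_marg P Q) \<le> ereal (cond_div Q J)"
    by (subst KL_eq) auto
  show "KL (out_marg P V) W = ereal (noise_div W J)" if "\<And>b. pmf W b = 0 \<Longrightarrow> marg_snd J b = 0"
  proof -
    have "KL (out_marg P V) W = ereal (\<Sum>b\<in>UNIV. marg_snd J b * ln (marg_snd J b / pmf W b))"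
      using that by (subst KL_eq) (auto simp: ms)
    then show ?thesis
      using that marg_snd_nonneg[OF J] by (simp add: mult_ln_ratio noise_div_def sum_subtractf)
  qed
  have "mutual_info (joint P V) = (\<Sum>z\<in>UNIV. J $ z * ln (J $ z / (pmf P (fst z) * marg_snd J (snd z))))"
    unfolding mutual_info_def map_fst_joint out_marg_def[symmetric] ms V
    by (rule sum.mono_neutral_left) (auto simp: less_le nn)
  also have "\<dots> = (\<Sum>z\<in>UNIV. J $ z * ln (J $ z / (\<Sum>a\<in>UNIV. J $ (a, snd z))) - J $ z * ln (pmf P (fst z)))"
  proof (intro sum.cong refl)
    fix z :: "'x \<times> 'y"
    show "J $ z * ln (J $ z / (pmf P (fst z) * marg_snd J (snd z))) =
      J $ z * ln (J $ z / (\<Sum>a\<in>UNIV. J $ (a, snd z))) - J $ z * ln (pmf P (fst z))"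
    proof (cases "J $ z = 0")
      case False
      then have p: "0 < J $ z" using nn[of z] by linarith
      have "J $ z \<le> marg_snd J (snd z)"
        unfolding marg_snd_def using member_le_sum[of "fst z" UNIV "\<lambda>a. J $ (a, snd z)"] nn by simp
      moreover have "0 < pmf P (fst z)"
        using False J'[of "fst z" "snd z"] by (auto simp: pmf_pos)
      ultimately show ?thesis
        using p by (simp add: marg_snd_def[symmetric] ln_div ln_mult algebra_simps)
    qed simp
  qed
  also have "\<dots> = info_div P J"
    by (simp add: sum_subtractf sum_ln_ratio_snd nn info_div_def marg_snd_def marg_fst_def)
       (simp add: sum_UNIV_pair sum_distrib_right)
  finally show "mutual_info (joint P V) = info_div P J" .
qed

section \<open>Windows of the output process\<close>

definition window_local :: "nat \<Rightarrow> ((nat \<Rightarrow> 'a) \<Rightarrow> bool) \<Rightarrow> bool" where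
  "window_local i R \<longleftrightarrow> (\<forall>u u'. (\<forall>j\<in>{1..i}. u j = u' j) \<longrightarrow> R u = R u')"

lemma window_localD:
  assumes "window_local i R" "\<And>j. j \<in> {1..i} \<Longrightarrow> u j = u' j"
  shows "R u = R u'"
  by (rule assms(1)[unfolded window_local_def, THEN spec, THEN spec, THEN mp]) (use assms(2) in blast)

text \<open>By locality the event about the outputs at times s + 1, ..., s + i is a finite disjoint
  union of cylinders, one for each accepted word.\<close>

lemma window_event:
  fixes p :: "nat \<Rightarrow> 'y::finite pmf"
  assumes R: "window_local i R"
  defines "M \<equiv> PiM UNIV (\<lambda>k. measure_pmf (p k))"
  shows "{y. R (\<lambda>j. y (s + j))} \<in> sets M"
    and "measure M {y. R (\<lambda>j. y (s + j))} = (\<Sum>v\<in>{v\<in>seqs i. R v}. \<Prod>j=1..i. pmf (p (s + j)) (v j))"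
proof -
  interpret product_prob_space "\<lambda>k. measure_pmf (p k)" UNIV
    by (rule product_prob_spaceI) (rule prob_space_measure_pmf)
  interpret PM: prob_space M
    unfolding M_def by (rule prob_space_PiM) (rule prob_space_measure_pmf)
  have space: "space M = UNIV" by (simp add: M_def space_PiM)
  define Z where "Z v = {y :: nat \<Rightarrow> 'y. \<forall>k\<in>{1+s..i+s}. y k = v (k - s)}" for v
  have Z_Collect: "Z v = {y \<in> space M. \<forall>k\<in>{1+s..i+s}. y k \<in> {v (k - s)}}" for v
    by (simp add: Z_def space)
  have Z_D: "y (s + j) = v j" if "y \<in> Z v" "j \<in> {1..i}" for y v j
  proof -
    have "s + j \<in> {1+s..i+s}" using that(2) by simp
    then have "y (s + j) = v (s + j - s)" using that(1) unfolding Z_def by blast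
    then show ?thesis by simp
  qed
  have Z_sets: "Z v \<in> sets M" for v
    unfolding Z_Collect by (intro sets.sets_Collect_finite_All) (auto simp: M_def)
  have Z_meas: "measure M (Z v) = (\<Prod>j=1..i. pmf (p (s + j)) (v j))" for v
  proof -
    have "emeasure M (Z v) = (\<Prod>k\<in>{1+s..i+s}. emeasure (measure_pmf (p k)) {v (k - s)})"
      unfolding Z_Collect M_def by (rule emeasure_PiM_Collect) auto
    also have "\<dots> = (\<Prod>k\<in>{1+s..i+s}. ennreal (pmf (p k) (v (k - s))))"
      by (simp add: emeasure_pmf_single)
    also have "\<dots> = ennreal (\<Prod>k\<in>{1+s..i+s}. pmf (p k) (v (k - s)))"
      by (rule prod_ennreal) simp
    also have "(\<Prod>k\<in>{1+s..i+s}. pmf (p k) (v (k - s))) = (\<Prod>j=1..i. pmf (p (s + j)) (v j))"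
      unfolding prod.shift_bounds_cl_nat_ivl by (simp add: add.commute)
    finally show ?thesis by (simp add: measure_def prod_nonneg)
  qed
  have eq: "{y. R (\<lambda>j. y (s + j))} = (\<Union>v\<in>{v\<in>seqs i. R v}. Z v)"
  proof (intro set_eqI iffI)
    fix y assume y: "y \<in> {y. R (\<lambda>j. y (s + j))}"
    let ?v = "restrict (\<lambda>j. y (s + j)) {1..i}"
    have "R ?v = R (\<lambda>j. y (s + j))"
      by (rule window_localD[OF R]) simp
    then have "?v \<in> {v\<in>seqs i. R v}" using y by (auto simp: seqs_def)
    moreover have "y \<in> Z ?v" by (auto simp: Z_def)
    ultimately show "y \<in> (\<Union>v\<in>{v\<in>seqs i. R v}. Z v)" by blast
  next
    fix y assume "y \<in> (\<Union>v\<in>{v\<in>seqs i. R v}. Z v)"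
    then obtain v where v: "R v" "y \<in> Z v" by auto
    have "y (s + j) = v j" if "j \<in> {1..i}" for j
      using v(2) that by (rule Z_D)
    then have "R (\<lambda>j. y (s + j)) = R v"
      by (rule window_localD[OF R])
    then show "y \<in> {y. R (\<lambda>j. y (s + j))}" using v by simp
  qed
  have disj: "disjoint_family_on Z {v\<in>seqs i. R v}"
    unfolding disjoint_family_on_def
  proof (intro ballI impI)
    fix v w assume vw: "v \<in> {v\<in>seqs i. R v}" "w \<in> {v\<in>seqs i. R v}" "v \<noteq> w"
    show "Z v \<inter> Z w = {}"
    proof (rule ccontr)
      assume "Z v \<inter> Z w \<noteq> {}"
      then obtain y where "y \<in> Z v" "y \<in> Z w" by blast
      then have "v j = w j" if "j \<in> {1..i}" for j
        using that Z_D by metis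
      moreover have "v \<in> PiE {1..i} (\<lambda>_. UNIV)" "w \<in> PiE {1..i} (\<lambda>_. UNIV)"
        using vw by (simp_all add: seqs_def)
      ultimately have "v = w" using PiE_ext[of v "{1..i}" "\<lambda>_. UNIV" w] by blast
      then show False using vw by simp
    qed
  qed
  show "{y. R (\<lambda>j. y (s + j))} \<in> sets M"
    unfolding eq by (rule sets.finite_UN) (auto simp: Z_sets)
  show "measure M {y. R (\<lambda>j. y (s + j))} = (\<Sum>v\<in>{v\<in>seqs i. R v}. \<Prod>j=1..i. pmf (p (s + j)) (v j))"
    unfolding eq using disj Z_sets
    by (subst PM.finite_measure_finite_Union) (auto simp: Z_meas)
qed

definition accept :: "'x::finite pmf \<Rightarrow> 'y::finite pmf \<Rightarrow> real \<Rightarrow> real \<Rightarrow> nat \<Rightarrow> (nat \<Rightarrow> 'x) \<Rightarrow> (nat \<Rightarrow> 'y) \<Rightarrow> bool" where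
  "accept P W L1 L2 i x u \<longleftrightarrow> noise_test W L1 i u \<and> codeword_test P L2 i x u"

lemma cnt_cong: "(\<And>j. j \<in> {1..i} \<Longrightarrow> z j = z' j) \<Longrightarrow> cnt z i a = cnt z' i a"
  unfolding cnt_def by (intro arg_cong[where f=card]) auto

lemma accept_local: "window_local i (accept P W L1 L2 i x)"
proof -
  have "accept P W L1 L2 i x u = accept P W L1 L2 i x u'" if "\<forall>j\<in>{1..i}. u j = u' j" for u u'
  proof -
    have c: "cnt u i = cnt u' i" "cnt (\<lambda>j. (x j, u j)) i = cnt (\<lambda>j. (x j, u' j)) i"
      using that by (auto intro!: ext cnt_cong)
    show ?thesis
      unfolding accept_def noise_test_def codeword_test_def c using that by simp
  qed
  then show ?thesis unfolding window_local_def by blast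
qed

section \<open>The sequential decoder\<close>

context
  fixes acc :: "nat \<Rightarrow> (nat \<Rightarrow> 'x) \<Rightarrow> (nat \<Rightarrow> 'y) \<Rightarrow> bool" and ks :: "nat set"
    and c :: "nat \<Rightarrow> nat \<Rightarrow> 'x" and M T :: nat
begin

text \<open>The window covers the times n - i + 1, ..., n; the guard \<open>i \<le> n\<close> keeps
  truncated subtraction from moving it past \<open>n\<close>.\<close>

definition hit :: "(nat \<Rightarrow> 'y) \<Rightarrow> nat \<Rightarrow> nat \<Rightarrow> bool" where
  "hit y n m \<longleftrightarrow> (\<exists>i\<in>ks. i \<le> n \<and> acc i (c m) (\<lambda>j. y (n - i + j)))"

text \<open>The deadline \<open>T\<close> is later set to A + N - 1, the last time at which a
  transmission can end; it bounds the delay on every path.\<close>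

definition stop_at :: "(nat \<Rightarrow> 'y) \<Rightarrow> nat" where
  "stop_at y = (LEAST n. T \<le> n \<or> (\<exists>m<M. hit y n m))"

text \<open>The output at time j sits at list position j - 1. The choice matters only when several
  codewords hit at once, and the error bound already counts that.\<close>

definition decode :: "'y list \<Rightarrow> nat" where
  "decode ys = (SOME m. m < M \<and> hit (\<lambda>j. ys ! (j - 1)) (length ys) m)"

lemma stop_at_le: "stop_at y \<le> T" "m < M \<Longrightarrow> hit y n m \<Longrightarrow> stop_at y \<le> n"
  unfolding stop_at_def by (auto intro: Least_le)

lemma stop_at_hit: "T \<le> stop_at y \<or> (\<exists>m<M. hit y (stop_at y) m)"
  unfolding stop_at_def by (rule LeastI[of _ T]) simp

context
  assumes loc: "\<And>i x. window_local i (acc i x)"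
begin

lemma hit_cong:
  assumes "\<And>j. j \<in> {1..n} \<Longrightarrow> y j = y' j"
  shows "hit y n m = hit y' n m"
proof -
  have "acc i (c m) (\<lambda>j. y (n - i + j)) = acc i (c m) (\<lambda>j. y' (n - i + j))" if "i \<le> n" for i
    by (rule window_localD[OF loc], rule assms) (use that in auto)
  then show ?thesis unfolding hit_def by (intro bex_cong refl conj_cong)
qed

lemma stopping_time_stop_at: "stopping_time_seq (\<lambda>y. enat (stop_at y))"
  unfolding stopping_time_seq_def
proof (intro allI impI)
  fix y y' :: "nat \<Rightarrow> 'y" and n
  assume n: "enat (stop_at y) = enat n" and eq: "\<forall>i\<in>{1..n}. y' i = y i"
  have h: "hit y' n' m = hit y n' m" if "n' \<le> n" for n' m
    using eq that by (intro hit_cong) auto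
  have "stop_at y' = n"
    unfolding stop_at_def
  proof (rule Least_equality)
    show "T \<le> n \<or> (\<exists>m<M. hit y' n m)" using stop_at_hit[of y] n h[of n] by auto
    fix n' assume *: "T \<le> n' \<or> (\<exists>m<M. hit y' n' m)"
    show "n \<le> n'"
    proof (rule ccontr)
      assume "\<not> n \<le> n'"
      then have "T \<le> n' \<or> (\<exists>m<M. hit y n' m)" using * h[of n'] by auto
      then have "stop_at y \<le> n'" unfolding stop_at_def by (rule Least_le)
      then show False using n \<open>\<not> n \<le> n'\<close> by simp
    qed
  qed
  then show "enat (stop_at y') = enat n" by simp
qed

lemma decode_hit:
  assumes "m < M" "hit y n m" and uniq: "\<And>m'. m' < M \<Longrightarrow> hit y n m' \<Longrightarrow> m' = m"
  shows "decode (map y [1..<Suc n]) = m"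
proof -
  let ?ys = "map y [1..<Suc n]"
  have "?ys ! (j - 1) = y j" if "j \<in> {1..n}" for j
    using that by (subst nth_map) (auto simp del: upt_Suc)
  then have "hit (\<lambda>j. ?ys ! (j - 1)) n m' = hit y n m'" for m'
    by (rule hit_cong)
  then have eq: "hit (\<lambda>j. ?ys ! (j - 1)) (length ?ys) m' = hit y n m'" for m'
    by (simp del: upt_Suc)
  show ?thesis
    unfolding decode_def eq by (rule some_equality) (use assms in blast)+
qed

text \<open>If the sent codeword passes on its full window, the decoder stops by time l + N - 1 on a
  hit. An error then means a hit on noise alone before \<open>l\<close>, or a hit of another
  codeword during transmission.\<close>

lemma err_event_subset:
  assumes l: "1 \<le> l" "l \<le> A" and N: "1 \<le> N" "N \<in> ks" and T: "T = A + N - 1" and m: "m < M"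
  shows "err_event (\<lambda>y. enat (stop_at y)) decode m \<subseteq>
    (\<Union>m'<M. \<Union>n<l. \<Union>i\<in>ks. if i \<le> n then {y. acc i (c m') (\<lambda>j. y (n - i + j))} else {})
    \<union> (\<Union>m'\<in>{..<M}-{m}. \<Union>n\<in>{l..l+N-1}. \<Union>i\<in>ks. if i \<le> n then {y. acc i (c m') (\<lambda>j. y (n - i + j))} else {})
    \<union> {y. \<not> acc N (c m) (\<lambda>j. y (l - 1 + j))}"
proof
  fix y assume y: "y \<in> err_event (\<lambda>y. enat (stop_at y)) decode m"
  let ?n = "stop_at y"
  have err: "decode (map y [1..<Suc ?n]) \<noteq> m" using y by (simp add: err_event_def)
  consider (miss) "\<not> acc N (c m) (\<lambda>j. y (l - 1 + j))"
    | (early) m' where "m' < M" "?n < l" "hit y ?n m'"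
    | (wrong) m' where "m' < M" "m' \<noteq> m" "l \<le> ?n" "?n \<le> l + N - 1" "hit y ?n m'"
  proof (cases "acc N (c m) (\<lambda>j. y (l - 1 + j))")
    case True
    then have hm: "hit y (l + N - 1) m"
      using N l unfolding hit_def by (intro bexI[of _ N]) (auto simp: Suc_diff_le)
    have le: "?n \<le> l + N - 1" using stop_at_le(2)[OF m hm] .
    \<comment> \<open>The deadline cannot be the only reason to stop: reaching \<open>T\<close>
      forces the stop at l + N - 1 = T, where the sent codeword hits.\<close>
    have "\<exists>m'<M. hit y ?n m'"
      using stop_at_hit[of y] le T l hm m by (cases "?n = l + N - 1") auto
    then obtain m' where m': "m' < M" "hit y ?n m'" by blast
    show thesis
    proof (cases "?n < l")
      case False
      have "\<exists>m''<M. hit y ?n m'' \<and> m'' \<noteq> m"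
      proof (rule ccontr)
        assume no: "\<not> ?thesis"
        then have "m' = m" using m' by blast
        then show False using decode_hit[of m y ?n] m' no err by blast
      qed
      then show thesis using that(3) le False by auto
    qed (use that m' in blast)
  qed (use that in blast)
  then show "y \<in> (\<Union>m'<M. \<Union>n<l. \<Union>i\<in>ks. if i \<le> n then {y. acc i (c m') (\<lambda>j. y (n - i + j))} else {})
    \<union> (\<Union>m'\<in>{..<M}-{m}. \<Union>n\<in>{l..l+N-1}. \<Union>i\<in>ks. if i \<le> n then {y. acc i (c m') (\<lambda>j. y (n - i + j))} else {})
    \<union> {y. \<not> acc N (c m) (\<lambda>j. y (l - 1 + j))}"
  proof cases
    case early
    then obtain i where "i \<in> ks" "i \<le> ?n" "acc i (c m') (\<lambda>j. y (?n - i + j))" by (auto simp: hit_def)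
    then have "y \<in> (\<Union>m'<M. \<Union>n<l. \<Union>i\<in>ks. if i \<le> n then {y. acc i (c m') (\<lambda>j. y (n - i + j))} else {})"
      using early by (intro UN_I[of m'] UN_I[of ?n] UN_I[of i]) auto
    then show ?thesis by blast
  next
    case wrong
    then obtain i where "i \<in> ks" "i \<le> ?n" "acc i (c m') (\<lambda>j. y (?n - i + j))" by (auto simp: hit_def)
    then have "y \<in> (\<Union>m'\<in>{..<M}-{m}. \<Union>n\<in>{l..l+N-1}. \<Union>i\<in>ks. if i \<le> n then {y. acc i (c m') (\<lambda>j. y (n - i + j))} else {})"
      using wrong by (intro UN_I[of m'] UN_I[of ?n] UN_I[of i]) auto
    then show ?thesis by blast
  qed auto
qed

text \<open>Success at length \<open>k\<close> gives delay at most \<open>k\<close>, success at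
  length \<open>N\<close> at most \<open>N\<close>, and the deadline covers the rest. Stopping
  before \<open>l\<close> counts as delay zero, so false alarms never hurt and the bound depends on
  misses only.\<close>

lemma stop_at_delay:
  assumes l: "1 \<le> l" "l \<le> A" and k: "1 \<le> k" "k \<in> ks" and N: "1 \<le> N" "N \<in> ks"
    and T: "T = A + N - 1" and m: "m < M"
  shows "ennreal_of_enat (enat (stop_at y) - enat l) \<le>
     ennreal (real k + real N * indicator {y. \<not> acc k (c m) (\<lambda>j. y (l - 1 + j))} y
       + real (A + N) * indicator {y. \<not> acc N (c m) (\<lambda>j. y (l - 1 + j))} y)"
proof -
  have h: "stop_at y \<le> l + i - 1" if "acc i (c m) (\<lambda>j. y (l - 1 + j))" "1 \<le> i" "i \<in> ks" for i
  proof (rule stop_at_le(2)[OF m])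
    show "hit y (l + i - 1) m"
      using that l unfolding hit_def by (intro bexI[of _ i]) (auto simp: Suc_diff_le)
  qed
  have "real (stop_at y - l) \<le> real k + real N * indicator {y. \<not> acc k (c m) (\<lambda>j. y (l - 1 + j))} y
       + real (A + N) * indicator {y. \<not> acc N (c m) (\<lambda>j. y (l - 1 + j))} y" (is "_ \<le> ?R")
  proof -
    consider "acc k (c m) (\<lambda>j. y (l - 1 + j))"
      | "\<not> acc k (c m) (\<lambda>j. y (l - 1 + j))" "acc N (c m) (\<lambda>j. y (l - 1 + j))"
      | "\<not> acc k (c m) (\<lambda>j. y (l - 1 + j))" "\<not> acc N (c m) (\<lambda>j. y (l - 1 + j))" by blast
    then show ?thesis
    proof cases
      case 1
      then have "stop_at y - l \<le> k" using h[of k] k by linarith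
      then show ?thesis by (simp add: add_increasing2)
    next
      case 2
      then have "stop_at y - l \<le> N" using h[of N] N by linarith
      then show ?thesis using 2 by simp
    next
      case 3
      have "stop_at y - l \<le> A + N" using stop_at_le(1)[of y] T by linarith
      then show ?thesis using 3 by simp
    qed
  qed
  then have "ennreal (real (stop_at y - l)) \<le> ennreal ?R" by (rule ennreal_leI)
  then show ?thesis by (simp add: ennreal_of_nat_eq_real_of_nat)
qed

end

end

section \<open>Random coding\<close>

definition iid :: "nat \<Rightarrow> 'a pmf \<Rightarrow> (nat \<Rightarrow> 'a) pmf" where
  "iid N P = Pi_pmf {1..N} undefined (\<lambda>_. P)"

lemma set_iid: "x \<in> set_pmf (iid N P) \<Longrightarrow> x \<in> seqs N \<and> (\<forall>j\<in>{1..N}. pmf P (x j) \<noteq> 0)"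
  unfolding iid_def by (auto simp: set_Pi_pmf PiE_dflt_def seqs_def PiE_def extensional_def set_pmf_iff)

lemma finite_set_iid: "finite (set_pmf (iid N (P :: 'a::finite pmf)))"
  by (rule finite_subset[OF _ finite_seqs[of N]]) (auto dest: set_iid)

lemma pmf_iid: "x \<in> seqs N \<Longrightarrow> pmf (iid N P) x = (\<Prod>j=1..N. pmf P (x j))"
  unfolding iid_def by (subst pmf_Pi') (auto simp: seqs_def PiE_def extensional_def)

lemma prob_iid:
  fixes P :: "'a::finite pmf"
  shows "measure_pmf.prob (iid N P) {x. R x} = (\<Sum>x\<in>{x\<in>seqs N. R x}. \<Prod>j=1..N. pmf P (x j))"
proof -
  have "measure_pmf.prob (iid N P) {x. R x} = measure_pmf.prob (iid N P) {x\<in>seqs N. R x}"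
    by (intro measure_pmf.finite_measure_eq_AE) (auto simp: AE_measure_pmf_iff dest: set_iid)
  also have "\<dots> = (\<Sum>x\<in>{x\<in>seqs N. R x}. pmf (iid N P) x)"
    by (rule measure_measure_pmf_finite) simp
  finally show ?thesis by (simp add: pmf_iid)
qed

lemma prob_iid_prefix:
  assumes "k \<le> N" "window_local k R"
  shows "measure_pmf.prob (iid N P) {x. R x} = measure_pmf.prob (iid k P) {x. R x}"
proof -
  have "iid k P = map_pmf (\<lambda>f x. if x \<in> {1..k} then f x else undefined) (iid N P)"
    unfolding iid_def using assms(1) by (intro Pi_pmf_subset) auto
  moreover have "R (\<lambda>x. if x \<in> {1..k} then f x else undefined) = R f" for f
    by (rule window_localD[OF assms(2)]) simp
  ultimately show ?thesis by (simp add: vimage_def)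
qed

lemma near_type_local: "window_local i (near_type P \<eta> i)"
proof -
  have "near_type P \<eta> i x = near_type P \<eta> i x'" if "\<forall>j\<in>{1..i}. x j = x' j" for x x'
  proof -
    have "cnt x i = cnt x' i" by (intro ext cnt_cong) (use that in blast)
    then show ?thesis by (simp add: near_type_def)
  qed
  then show ?thesis unfolding window_local_def by blast
qed

text \<open>Conditioning on typicality at most doubles every probability, so the false alarm bounds
  computed for i.i.d. codewords survive up to a factor 2.\<close>

lemma prob_cond_pmf_le:
  assumes half: "1 / 2 \<le> measure_pmf.prob p G" and fin: "finite (set_pmf p)"
  shows "measure_pmf.prob (cond_pmf p G) S \<le> 2 * measure_pmf.prob p S"
    and "set_pmf (cond_pmf p G) = set_pmf p \<inter> G"
proof -
  have ne: "set_pmf p \<inter> G \<noteq> {}"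
    using half measure_Int_set_pmf[of p G] by (auto simp: Int_commute)
  show set: "set_pmf (cond_pmf p G) = set_pmf p \<inter> G" by (rule set_cond_pmf[OF ne])
  have "measure_pmf.prob (cond_pmf p G) S = measure_pmf.prob (cond_pmf p G) (S \<inter> set_pmf p)"
    by (intro measure_pmf.finite_measure_eq_AE) (auto simp: AE_measure_pmf_iff set)
  also have "\<dots> = (\<Sum>x\<in>S \<inter> set_pmf p. pmf (cond_pmf p G) x)"
    by (rule measure_measure_pmf_finite) (use fin in simp)
  also have "\<dots> \<le> (\<Sum>x\<in>S \<inter> set_pmf p. 2 * pmf p x)"
  proof (rule sum_mono)
    fix x
    have "pmf p x \<le> 2 * pmf p x * measure_pmf.prob p G"
      using mult_left_mono[OF half, of "2 * pmf p x"] by simp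
    then show "pmf (cond_pmf p G) x \<le> 2 * pmf p x"
      using half by (simp add: pmf_cond[OF ne] divide_le_eq)
  qed
  also have "\<dots> = 2 * measure_pmf.prob p (S \<inter> set_pmf p)"
    using fin by (simp add: measure_measure_pmf_finite sum_distrib_left)
  finally show "measure_pmf.prob (cond_pmf p G) S \<le> 2 * measure_pmf.prob p S"
    by (simp add: measure_Int_set_pmf)
qed

text \<open>The witness lies in the support; this makes every codeword of the selected code
  typical.\<close>

lemma exists_le_expectation:
  fixes F :: "'a \<Rightarrow> real"
  assumes "finite (set_pmf p)" "measure_pmf.expectation p F \<le> K"
  shows "\<exists>c\<in>set_pmf p. F c \<le> K"
proof (rule ccontr)
  assume "\<not> ?thesis"
  then have gt: "K < F c" if "c \<in> set_pmf p" for c using that by (meson not_le)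
  have "K = (\<Sum>c\<in>set_pmf p. K * pmf p c)"
    using assms(1) by (simp add: sum_distrib_left[symmetric] sum_pmf_eq_1)
  also have "\<dots> < (\<Sum>c\<in>set_pmf p. F c * pmf p c)"
    using assms(1) gt by (intro sum_strict_mono mult_strict_right_mono) (auto simp: set_pmf_not_empty pmf_positive)
  also have "\<dots> = measure_pmf.expectation p F"
    using assms(1) by (subst integral_measure_pmf_real[of "set_pmf p"]) auto
  finally show False using assms(2) by simp
qed

lemma finite_set_Pi_pmf:
  "finite I \<Longrightarrow> (\<And>i. i \<in> I \<Longrightarrow> finite (set_pmf (p i))) \<Longrightarrow> finite (set_pmf (Pi_pmf I d p))"
  by (simp add: set_Pi_pmf finite_PiE_dflt)

text \<open>Codeword \<open>m\<close> is redrawn while the others stay fixed. Independence of a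
  wrong codeword from the transmitted one enters the proof here.\<close>

lemma expectation_Pi_pmf_update_le:
  fixes F :: "('i \<Rightarrow> 'a) \<Rightarrow> real"
  assumes I: "finite I" "m \<in> I" and p: "finite (set_pmf p)"
    and le: "\<And>c. measure_pmf.expectation p (\<lambda>x. F (c(m := x))) \<le> K"
  shows "measure_pmf.expectation (Pi_pmf I d (\<lambda>_. p)) F \<le> K"
proof -
  define q where "q = Pi_pmf (I - {m}) d (\<lambda>_. p)"
  have q: "finite (set_pmf q)" unfolding q_def using I p by (intro finite_set_Pi_pmf) auto
  have "Pi_pmf I d (\<lambda>_. p) = Pi_pmf (insert m (I - {m})) d (\<lambda>_. p)"
    using I by (simp add: insert_absorb)
  also have "\<dots> = map_pmf (\<lambda>(y, f). f(m := y)) (pair_pmf p q)"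
    unfolding q_def using I by (subst Pi_pmf_insert) auto
  finally have "measure_pmf.expectation (Pi_pmf I d (\<lambda>_. p)) F
      = measure_pmf.expectation (pair_pmf p q) (\<lambda>(x, c). F (c(m := x)))"
    by (simp add: case_prod_beta')
  also have "\<dots> = (\<Sum>(x, c)\<in>set_pmf p \<times> set_pmf q. F (c(m := x)) * (pmf p x * pmf q c))"
    using p q by (subst integral_measure_pmf_real[of "set_pmf p \<times> set_pmf q"])
      (auto simp: pmf_pair intro!: sum.cong)
  also have "\<dots> = (\<Sum>c\<in>set_pmf q. pmf q c * (\<Sum>x\<in>set_pmf p. F (c(m := x)) * pmf p x))"
    unfolding sum.cartesian_product[symmetric] sum_distrib_left
    by (subst sum.swap) (simp add: mult_ac)
  also have "\<dots> \<le> (\<Sum>c\<in>set_pmf q. pmf q c * K)"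
  proof (intro sum_mono mult_left_mono)
    fix c
    show "(\<Sum>x\<in>set_pmf p. F (c(m := x)) * pmf p x) \<le> K"
      using le[of c] p by (subst (asm) integral_measure_pmf_real[of "set_pmf p"]) auto
  qed simp
  also have "\<dots> = K" using q by (simp add: sum_distrib_right[symmetric] sum_pmf_eq_1)
  finally show ?thesis .
qed

text \<open>After exchanging sum and expectation the two tests separate: \<open>g\<close> bears the
  noise test, the random codeword bears the other, uniformly in \<open>u\<close>.\<close>

lemma expectation_accept_le:
  fixes g :: "(nat \<Rightarrow> 'y::finite) \<Rightarrow> real"
  assumes fin: "finite (set_pmf p)" and g: "\<And>u. 0 \<le> g u"
    and B: "\<And>u :: nat \<Rightarrow> 'y. measure_pmf.prob p {x. codeword_test P L2 i x u} \<le> B"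
  shows "measure_pmf.expectation p (\<lambda>x. \<Sum>u\<in>{u\<in>seqs i. accept P W L1 L2 i x u}. g u)
     \<le> B * (\<Sum>u\<in>{u\<in>seqs i. noise_test W L1 i u}. g u)"
proof -
  let ?S = "{u\<in>seqs i. noise_test W L1 i u}"
  have eq: "(\<Sum>u\<in>{u\<in>seqs i. accept P W L1 L2 i x u}. g u)
      = (\<Sum>u\<in>?S. g u * indicator {x. codeword_test P L2 i x u} x)" for x
    by (rule sum.mono_neutral_cong_left) (auto simp: accept_def indicator_def)
  have "measure_pmf.expectation p (\<lambda>x. \<Sum>u\<in>{u\<in>seqs i. accept P W L1 L2 i x u}. g u)
      = (\<Sum>u\<in>?S. measure_pmf.expectation p (\<lambda>x. g u * indicator {x. codeword_test P L2 i x u} x))"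
    by (simp only: eq Bochner_Integration.integral_sum integrable_measure_pmf_finite[OF fin])
  also have "\<dots> = (\<Sum>u\<in>?S. g u * measure_pmf.prob p {x. codeword_test P L2 i x u})"
    by simp
  also have "\<dots> \<le> (\<Sum>u\<in>?S. g u * B)"
    by (intro sum_mono mult_left_mono B g)
  finally show ?thesis by (simp add: sum_distrib_left mult.commute)
qed

section \<open>False alarm and miss probabilities of a code\<close>

definition fa_noise :: "'x::finite pmf \<Rightarrow> 'y::finite pmf \<Rightarrow> real \<Rightarrow> real \<Rightarrow> nat \<Rightarrow> (nat \<Rightarrow> 'x) \<Rightarrow> real" where
  "fa_noise P W L1 L2 i x = (\<Sum>u\<in>{u\<in>seqs i. accept P W L1 L2 i x u}. \<Prod>j=1..i. pmf W (u j))"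

text \<open>The window may straddle the start of the transmission and mix noise with letters of
  codeword \<open>m\<close>.\<close>

definition fa_wrong :: "'x::finite pmf \<Rightarrow> ('x \<Rightarrow> 'y::finite pmf) \<Rightarrow> 'x \<Rightarrow> real \<Rightarrow> real \<Rightarrow> nat
    \<Rightarrow> (nat \<Rightarrow> nat \<Rightarrow> 'x) \<Rightarrow> nat \<Rightarrow> nat \<Rightarrow> nat \<Rightarrow> nat \<Rightarrow> nat \<Rightarrow> real" where
  "fa_wrong P Q star L1 L2 N c m l n i m' = (\<Sum>u\<in>{u\<in>seqs i. accept P (Q star) L1 L2 i (c m') u}.
      \<Prod>j=1..i. pmf (out_dist Q star N c m l (n - i + j)) (u j))"

definition miss_prob :: "'x::finite pmf \<Rightarrow> ('x \<Rightarrow> 'y::finite pmf) \<Rightarrow> 'x \<Rightarrow> real \<Rightarrow> real \<Rightarrow> nat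
    \<Rightarrow> (nat \<Rightarrow> 'x) \<Rightarrow> real" where
  "miss_prob P Q star L1 L2 i x = (\<Sum>u\<in>{u\<in>seqs i. \<not> accept P (Q star) L1 L2 i x u}.
      \<Prod>j=1..i. pmf (Q (x j)) (u j))"

lemma miss_prob_bound:
  fixes Q :: "'x::finite \<Rightarrow> 'y::finite pmf"
  assumes gap: "\<forall>J\<in>feasible Q \<inter> miss_set P (Q star) r1 r2. marg_fst J = pmf P \<longrightarrow> \<alpha> < cond_div Q J"
  shows "\<exists>\<eta>>0. \<exists>\<gamma>>0. \<forall>i x L1 L2. 1 \<le> i \<longrightarrow> (\<forall>j\<in>{1..i}. pmf P (x j) \<noteq> 0) \<longrightarrow> near_type P \<eta> i x \<longrightarrow>
     L1 \<le> real i * r1 \<longrightarrow> L2 \<le> real i * r2 \<longrightarrow>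
     miss_prob P Q star L1 L2 i x \<le> real ((i + 1) ^ CARD('x \<times> 'y)) * exp (- (real i * (\<alpha> + \<gamma>)))"
  unfolding miss_prob_def accept_def by (rule miss_bound) (use gap in blast)

lemma random_code:
  fixes P :: "'x::finite pmf" and Q :: "'x \<Rightarrow> 'y::finite pmf"
  assumes fin: "finite (set_pmf p)" and ks: "finite ks" and nn: "0 \<le> B1" "0 \<le> B2"
    and B2: "\<And>i u. i \<in> ks \<Longrightarrow> measure_pmf.prob p {x. codeword_test P L2 i x (u :: nat \<Rightarrow> 'y)} \<le> B2"
    and B1: "\<And>i. i \<in> ks \<Longrightarrow> (\<Sum>u\<in>{u\<in>seqs i. noise_test (Q star) L1 i u}. \<Prod>j=1..i. pmf (Q star) (u j)) \<le> B1"
  shows "\<exists>c. (\<forall>m<M. c m \<in> set_pmf p) \<and>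
    (\<Sum>m<M. \<Sum>l\<in>{1..A}. (\<Sum>m'<M. \<Sum>n<l. \<Sum>i\<in>ks. fa_noise P (Q star) L1 L2 i (c m'))
       + (\<Sum>m'\<in>{..<M}-{m}. \<Sum>n\<in>{l..l+N-1}. \<Sum>i\<in>ks. fa_wrong P Q star L1 L2 N c m l n i m'))
    \<le> real A * real M * (real M * real A * real (card ks) * (B1 * B2) + real M * real N * real (card ks) * B2)"
    (is "\<exists>c. _ \<and> ?F c \<le> ?K")
proof -
  let ?q = "Pi_pmf {..<M} undefined (\<lambda>_. p)"
  let ?E = "measure_pmf.expectation ?q"
  have finq: "finite (set_pmf ?q)" using fin by (intro finite_set_Pi_pmf) auto
  have E1: "?E (\<lambda>c. fa_noise P (Q star) L1 L2 i (c m')) \<le> B1 * B2" if "m' < M" "i \<in> ks" for m' i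
  proof (rule expectation_Pi_pmf_update_le[OF _ _ fin, where m = m'])
    fix c
    have "measure_pmf.expectation p (\<lambda>x. fa_noise P (Q star) L1 L2 i x)
      \<le> B2 * (\<Sum>u\<in>{u\<in>seqs i. noise_test (Q star) L1 i u}. \<Prod>j=1..i. pmf (Q star) (u j))"
      unfolding fa_noise_def using B2[OF that(2)] by (intro expectation_accept_le fin prod_nonneg) auto
    also have "\<dots> \<le> B2 * B1" using B1[OF that(2)] nn by (intro mult_left_mono)
    finally show "measure_pmf.expectation p (\<lambda>x. fa_noise P (Q star) L1 L2 i ((c(m' := x)) m')) \<le> B1 * B2"
      by (simp add: mult.commute)
  qed (use that in auto)
  have E2: "?E (\<lambda>c. fa_wrong P Q star L1 L2 N c m l n i m') \<le> B2"
    if "m' < M" "i \<in> ks" "m \<noteq> m'" for m m' i l n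
  proof (rule expectation_Pi_pmf_update_le[OF _ _ fin, where m = m'])
    fix c :: "nat \<Rightarrow> nat \<Rightarrow> 'x"
    \<comment> \<open>Redrawing a wrong codeword leaves the output law unchanged.\<close>
    have o: "out_dist Q star N (c(m' := x)) m l = out_dist Q star N c m l" for x
      using that(3) by (auto simp: out_dist_def)
    have "measure_pmf.expectation p (\<lambda>x. fa_wrong P Q star L1 L2 N (c(m' := x)) m l n i m')
      \<le> B2 * (\<Sum>u\<in>{u\<in>seqs i. noise_test (Q star) L1 i u}.
          \<Prod>j=1..i. pmf (out_dist Q star N c m l (n - i + j)) (u j))"
      unfolding fa_wrong_def o fun_upd_same
      using B2[OF that(2)] by (intro expectation_accept_le fin prod_nonneg) auto
    \<comment> \<open>During transmission the noise test offers no protection; its sum is bounded by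
      total mass one.\<close>
    also have "\<dots> \<le> B2 * 1"
      using nn by (intro mult_left_mono sum_kernel_le_1) (auto simp: sum_pmf_eq_1)
    finally show "measure_pmf.expectation p (\<lambda>x. fa_wrong P Q star L1 L2 N (c(m' := x)) m l n i m') \<le> B2"
      by simp
  qed (use that in auto)
  note int = integrable_measure_pmf_finite[OF finq]
  have "?E ?F = (\<Sum>m<M. \<Sum>l\<in>{1..A}. (\<Sum>m'<M. \<Sum>n<l. \<Sum>i\<in>ks. ?E (\<lambda>c. fa_noise P (Q star) L1 L2 i (c m')))
       + (\<Sum>m'\<in>{..<M}-{m}. \<Sum>n\<in>{l..l+N-1}. \<Sum>i\<in>ks. ?E (\<lambda>c. fa_wrong P Q star L1 L2 N c m l n i m')))"
    by (simp only: Bochner_Integration.integral_sum Bochner_Integration.integral_add int)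
  also have "\<dots> \<le> (\<Sum>m<M. \<Sum>l\<in>{1..A}. real M * real A * real (card ks) * (B1 * B2)
       + real M * real N * real (card ks) * B2)"
  proof (intro sum_mono add_mono)
    fix m l assume ml: "m \<in> {..<M}" "l \<in> {1..A}"
    have "(\<Sum>m'<M. \<Sum>n<l. \<Sum>i\<in>ks. ?E (\<lambda>c. fa_noise P (Q star) L1 L2 i (c m')))
      \<le> (\<Sum>m'<M. \<Sum>n<l. \<Sum>i\<in>ks. B1 * B2)"
      by (intro sum_mono E1) auto
    also have "\<dots> = real M * (real l * (real (card ks) * (B1 * B2)))" by simp
    also have "\<dots> \<le> real M * (real A * (real (card ks) * (B1 * B2)))"
      using ml nn by (intro mult_left_mono mult_right_mono) auto
    finally show "(\<Sum>m'<M. \<Sum>n<l. \<Sum>i\<in>ks. ?E (\<lambda>c. fa_noise P (Q star) L1 L2 i (c m')))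
      \<le> real M * real A * real (card ks) * (B1 * B2)" by (simp add: mult.assoc)
    have "(\<Sum>m'\<in>{..<M}-{m}. \<Sum>n\<in>{l..l+N-1}. \<Sum>i\<in>ks. ?E (\<lambda>c. fa_wrong P Q star L1 L2 N c m l n i m'))
      \<le> (\<Sum>m'\<in>{..<M}-{m}. \<Sum>n\<in>{l..l+N-1}. \<Sum>i\<in>ks. B2)"
      by (intro sum_mono E2) auto
    also have "\<dots> = real (card ({..<M}-{m})) * (real (card {l..l+N-1}) * (real (card ks) * B2))" by simp
    also have "\<dots> \<le> real M * (real N * (real (card ks) * B2))"
    proof (intro mult_mono of_nat_mono)
      have "card ({..<M}-{m}) \<le> card {..<M}" by (intro card_mono) auto
      then show "card ({..<M}-{m}) \<le> M" by simp
    qed (use nn ml in auto)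
    finally show "(\<Sum>m'\<in>{..<M}-{m}. \<Sum>n\<in>{l..l+N-1}. \<Sum>i\<in>ks. ?E (\<lambda>c. fa_wrong P Q star L1 L2 N c m l n i m'))
      \<le> real M * real N * real (card ks) * B2" by (simp add: mult.assoc)
  qed
  also have "\<dots> = ?K" by simp
  finally have "?E ?F \<le> ?K" .
  then obtain c where c: "c \<in> set_pmf ?q" "?F c \<le> ?K"
    using exists_le_expectation[OF finq] by blast
  have "c m \<in> set_pmf p" if "m < M" for m
    using c(1) that by (auto simp: set_Pi_pmf PiE_dflt_def)
  then show ?thesis using c(2) by blast
qed

lemma measure_UN_le:
  assumes "finite I" "prob_space M" "\<And>i. i \<in> I \<Longrightarrow> S i \<in> sets M \<and> measure M (S i) \<le> f i"
  shows "(\<Union>i\<in>I. S i) \<in> sets M \<and> measure M (\<Union>i\<in>I. S i) \<le> (\<Sum>i\<in>I. f i)"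
proof -
  interpret prob_space M by fact
  have "measure M (\<Union>i\<in>I. S i) \<le> (\<Sum>i\<in>I. measure M (S i))"
    using assms by (intro finite_measure_subadditive_finite) auto
  also have "\<dots> \<le> (\<Sum>i\<in>I. f i)" using assms by (intro sum_mono) auto
  finally show ?thesis using assms by auto
qed

lemma prob_space_out_meas: "prob_space (out_meas Q star N c m l)"
  unfolding out_meas_def by (rule prob_space_PiM) (rule prob_space_measure_pmf)

lemma not_accept_local: "window_local i (\<lambda>u. \<not> accept P W L1 L2 i x u)"
  using accept_local[of i P W L1 L2 x] unfolding window_local_def by simp

lemma miss_event:
  assumes "1 \<le> i" "i \<le> N" "1 \<le> l"
  shows "{y. \<not> accept P (Q star) L1 L2 i (c m) (\<lambda>j. y (l - 1 + j))} \<in> sets (out_meas Q star N c m l)"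
    and "measure (out_meas Q star N c m l) {y. \<not> accept P (Q star) L1 L2 i (c m) (\<lambda>j. y (l - 1 + j))}
      = miss_prob P Q star L1 L2 i (c m)"
proof -
  have "out_dist Q star N c m l (l - 1 + j) = Q (c m j)" if "j \<in> {1..i}" for j
    using that assms by (auto simp: out_dist_def)
  then show "measure (out_meas Q star N c m l) {y. \<not> accept P (Q star) L1 L2 i (c m) (\<lambda>j. y (l - 1 + j))}
      = miss_prob P Q star L1 L2 i (c m)"
    unfolding out_meas_def miss_prob_def by (subst window_event(2)[OF not_accept_local]) simp
qed (auto simp: out_meas_def intro: window_event(1)[OF not_accept_local])

lemma err_event_measure_le:
  fixes P :: "'x::finite pmf" and Q :: "'x \<Rightarrow> 'y::finite pmf" and star :: 'x and L1 L2 :: real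
  assumes l: "1 \<le> l" "l \<le> A" and N: "1 \<le> N" "N \<in> ks" and ks: "finite ks" and m: "m < M"
  defines "acc \<equiv> accept P (Q star) L1 L2" and "T \<equiv> A + N - 1"
  shows "measure (out_meas Q star N c m l) (err_event (\<lambda>y. enat (stop_at acc ks c M T y)) (decode acc ks c M) m)
    \<le> (\<Sum>m'<M. \<Sum>n<l. \<Sum>i\<in>ks. fa_noise P (Q star) L1 L2 i (c m'))
       + (\<Sum>m'\<in>{..<M}-{m}. \<Sum>n\<in>{l..l+N-1}. \<Sum>i\<in>ks. fa_wrong P Q star L1 L2 N c m l n i m')
       + miss_prob P Q star L1 L2 N (c m)"
proof -
  let ?\<mu> = "out_meas Q star N c m l"
  interpret prob_space ?\<mu> by (rule prob_space_out_meas)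
  define S where "S i n m' = (if i \<le> n then {y. acc i (c m') (\<lambda>j. y (n - i + j))} else {})" for i n m'
  have loc: "window_local i (acc i x)" for i x unfolding acc_def by (rule accept_local)
  have ev: "{y. acc i (c m') (\<lambda>j. y (n - i + j))} \<in> sets ?\<mu>"
    "measure ?\<mu> {y. acc i (c m') (\<lambda>j. y (n - i + j))} = fa_wrong P Q star L1 L2 N c m l n i m'" for i n m'
    using window_event[OF loc[of i "c m'"], where s = "n - i" and p = "out_dist Q star N c m l"]
    unfolding out_meas_def fa_wrong_def acc_def by auto
  have nn: "0 \<le> fa_wrong P Q star L1 L2 N c m l n i m'" "0 \<le> fa_noise P (Q star) L1 L2 i (c m')" for n i m'
    unfolding fa_wrong_def fa_noise_def by (auto intro!: sum_nonneg prod_nonneg)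
  have S: "S i n m' \<in> sets ?\<mu> \<and> measure ?\<mu> (S i n m') \<le> fa_wrong P Q star L1 L2 N c m l n i m'" for i n m'
  proof (cases "i \<le> n")
    case True
    then have eq: "S i n m' = {y. acc i (c m') (\<lambda>j. y (n - i + j))}" unfolding S_def by (rule if_P)
    show ?thesis unfolding eq using ev by (intro conjI eq_refl)
  qed (simp add: S_def nn)
  have 1: "(\<Union>m'<M. \<Union>n<l. \<Union>i\<in>ks. S i n m') \<in> sets ?\<mu> \<and> measure ?\<mu> (\<Union>m'<M. \<Union>n<l. \<Union>i\<in>ks. S i n m')
      \<le> (\<Sum>m'<M. \<Sum>n<l. \<Sum>i\<in>ks. fa_noise P (Q star) L1 L2 i (c m'))"
  proof (intro measure_UN_le prob_space_out_meas ks finite_lessThan)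
    fix m' n i assume n: "n \<in> {..<l}"
    \<comment> \<open>A window ending before \<open>l\<close> sees noise only, whichever message is
      sent.\<close>
    have eq: "fa_wrong P Q star L1 L2 N c m l n i m' = fa_noise P (Q star) L1 L2 i (c m')" if "i \<le> n"
    proof -
      have "out_dist Q star N c m l (n - i + j) = Q star" if "j \<in> {1..i}" for j
        using that n \<open>i \<le> n\<close> by (auto simp: out_dist_def)
      then show ?thesis unfolding fa_wrong_def fa_noise_def by simp
    qed
    show "S i n m' \<in> sets ?\<mu> \<and> measure ?\<mu> (S i n m') \<le> fa_noise P (Q star) L1 L2 i (c m')"
      using S[of i n m'] eq nn by (cases "i \<le> n") (auto simp: S_def)
  qed
  have 2: "(\<Union>m'\<in>{..<M}-{m}. \<Union>n\<in>{l..l+N-1}. \<Union>i\<in>ks. S i n m') \<in> sets ?\<mu> \<and>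
      measure ?\<mu> (\<Union>m'\<in>{..<M}-{m}. \<Union>n\<in>{l..l+N-1}. \<Union>i\<in>ks. S i n m')
      \<le> (\<Sum>m'\<in>{..<M}-{m}. \<Sum>n\<in>{l..l+N-1}. \<Sum>i\<in>ks. fa_wrong P Q star L1 L2 N c m l n i m')"
    by (intro measure_UN_le prob_space_out_meas ks finite_Diff finite_lessThan finite_atLeastAtMost S)
  have 3: "{y. \<not> acc N (c m) (\<lambda>j. y (l - 1 + j))} \<in> sets ?\<mu>"
    "measure ?\<mu> {y. \<not> acc N (c m) (\<lambda>j. y (l - 1 + j))} = miss_prob P Q star L1 L2 N (c m)"
    unfolding acc_def by (rule miss_event; use N l in simp)+
  have "measure ?\<mu> (err_event (\<lambda>y. enat (stop_at acc ks c M T y)) (decode acc ks c M) m)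
    \<le> measure ?\<mu> ((\<Union>m'<M. \<Union>n<l. \<Union>i\<in>ks. S i n m') \<union>
        (\<Union>m'\<in>{..<M}-{m}. \<Union>n\<in>{l..l+N-1}. \<Union>i\<in>ks. S i n m') \<union> {y. \<not> acc N (c m) (\<lambda>j. y (l - 1 + j))})"
    using 1 2 3(1) unfolding S_def by (intro finite_measure_mono err_event_subset[OF loc l N _ m]) (auto simp: T_def)
  also have "\<dots> \<le> measure ?\<mu> (\<Union>m'<M. \<Union>n<l. \<Union>i\<in>ks. S i n m') +
        measure ?\<mu> (\<Union>m'\<in>{..<M}-{m}. \<Union>n\<in>{l..l+N-1}. \<Union>i\<in>ks. S i n m') +
        measure ?\<mu> {y. \<not> acc N (c m) (\<lambda>j. y (l - 1 + j))}"
    using 1 2 3(1)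
    by (intro order_trans[OF measure_subadditive] add_right_mono measure_subadditive sets.Un) auto
  finally show ?thesis using 1 2 3(2) by linarith
qed

lemma delay_le:
  fixes P :: "'x::finite pmf" and Q :: "'x \<Rightarrow> 'y::finite pmf" and star :: 'x and L1 L2 :: real
  assumes A: "1 \<le> A" and M: "1 \<le> M" and k: "1 \<le> k" "k \<le> N" "k \<in> ks" and N: "1 \<le> N" "N \<in> ks"
    and p1: "\<And>m. m < M \<Longrightarrow> miss_prob P Q star L1 L2 k (c m) \<le> p1"
    and p2: "\<And>m. m < M \<Longrightarrow> miss_prob P Q star L1 L2 N (c m) \<le> p2"
  defines "acc \<equiv> accept P (Q star) L1 L2" and "T \<equiv> A + N - 1"
  shows "delay Q star A M N c (\<lambda>y. enat (stop_at acc ks c M T y))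
    \<le> ennreal (real k + real N * p1 + real (A + N) * p2)"
proof -
  let ?B = "real k + real N * p1 + real (A + N) * p2"
  have loc: "window_local i (acc i x)" for i x unfolding acc_def by (rule accept_local)
  have "(\<integral>\<^sup>+ y. ennreal_of_enat (enat (stop_at acc ks c M T y) - enat l) \<partial>out_meas Q star N c m l) \<le> ennreal ?B"
    if m: "m < M" and l: "1 \<le> l" "l \<le> A" for m l
  proof -
    let ?\<mu> = "out_meas Q star N c m l"
    interpret prob_space ?\<mu> by (rule prob_space_out_meas)
    define E where "E i = {y. \<not> acc i (c m) (\<lambda>j. y (l - 1 + j))}" for i
    have ev: "E i \<in> sets ?\<mu>" "measure ?\<mu> (E i) = miss_prob P Q star L1 L2 i (c m)" if "1 \<le> i" "i \<le> N" for i
      unfolding acc_def E_def by (rule miss_event; use that l in simp)+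
    have I: "integrable ?\<mu> (indicat_real (E i))" if "1 \<le> i" "i \<le> N" for i
      using ev(1)[OF that] by (intro integrable_real_indicator) (auto simp: emeasure_eq_measure)
    have "(\<integral>\<^sup>+ y. ennreal_of_enat (enat (stop_at acc ks c M T y) - enat l) \<partial>?\<mu>)
      \<le> (\<integral>\<^sup>+ y. ennreal (real k + real N * indicator (E k) y + real (A + N) * indicator (E N) y) \<partial>?\<mu>)"
      unfolding E_def by (intro nn_integral_mono stop_at_delay[OF loc l k(1,3) N _ m]) (simp add: T_def)
    also have "\<dots> = ennreal (\<integral>y. real k + real N * indicator (E k) y + real (A + N) * indicator (E N) y \<partial>?\<mu>)"
      using I[OF k(1,2)] I[OF N(1) order_refl]
      by (intro nn_integral_eq_integral Bochner_Integration.integrable_add integrable_mult_right) auto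
    also have "(\<integral>y. real k + real N * indicator (E k) y + real (A + N) * indicator (E N) y \<partial>?\<mu>)
      = real k + real N * measure ?\<mu> (E k) + real (A + N) * measure ?\<mu> (E N)"
      using I[OF k(1,2)] I[OF N(1) order_refl] ev[OF k(1,2)] ev[OF N(1) order_refl]
      by (simp add: prob_space)
    also have "ennreal \<dots> \<le> ennreal ?B"
      using ev k N p1[OF m] p2[OF m] by (intro ennreal_leI add_mono mult_left_mono) auto
    finally show ?thesis .
  qed
  then have "delay Q star A M N c (\<lambda>y. enat (stop_at acc ks c M T y))
    \<le> (\<Sum>m<M. \<Sum>l\<in>{1..A}. ennreal ?B) / (of_nat A * of_nat M)"
    unfolding delay_def by (intro divide_right_mono_ennreal sum_mono) auto
  also have "\<dots> = ennreal ?B * (of_nat A * of_nat M) / (of_nat A * of_nat M)"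
    by (simp add: mult_ac)
  also have "\<dots> = ennreal ?B"
    using A M by (intro ennreal_mult_divide_eq) (auto simp: ennreal_mult_eq_top_iff)
  finally show ?thesis .
qed

section \<open>Asymptotics\<close>

lemma eventually_poly_exp_le:
  fixes c C :: real
  assumes "0 < c" "0 < C"
  shows "eventually (\<lambda>N. real ((N + 1) ^ d) * exp (- (c * real N)) \<le> C) sequentially"
proof -
  have "(\<lambda>N. real ((N + 1) ^ d) * exp (- (c * real N))) \<longlonglongrightarrow> 0"
    using assms(1) by real_asymp
  then have "eventually (\<lambda>N. real ((N + 1) ^ d) * exp (- (c * real N)) < C) sequentially"
    using assms(2) by (rule order_tendstoD)
  then show ?thesis by (rule eventually_mono) simp
qed

text \<open>Here \<open>s1\<close>, \<open>s2\<close> are the thresholds per letter at length N, and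
  \<open>r1\<close>, \<open>r2\<close> upper bounds for them at length about \<kappa> N. The
  conditions \<open>s\<close> make the two false alarm exponents positive,
  \<open>R * \<kappa> < \<beta>\<close> is the rate condition, and the factor 2 in the bound on
  \<open>A\<close> absorbs a ceiling.\<close>

lemma achievable_core:
  fixes Q :: "'x::finite \<Rightarrow> 'y::finite pmf" and P :: "'x pmf"
  assumes gapN: "\<forall>J\<in>feasible Q \<inter> miss_set P (Q star) s1 s2. marg_fst J = pmf P \<longrightarrow> \<alpha> < cond_div Q J"
    and gapk: "\<forall>J\<in>feasible Q \<inter> miss_set P (Q star) r1 r2. marg_fst J = pmf P \<longrightarrow> 0 < cond_div Q J"
    and \<alpha>: "0 \<le> \<alpha>" and \<beta>: "0 < \<beta>" and \<kappa>: "0 < \<kappa>" "\<kappa> < 1" and r: "0 \<le> r1" "0 \<le> r2"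
    and sr: "s1 \<le> \<kappa> * r1" "s2 \<le> \<kappa> * r2" and s: "\<alpha> + \<beta> < s1 + s2" "\<beta> < s2"
    and R: "R * \<kappa> < \<beta>" and \<epsilon>: "0 < \<epsilon>"
  shows "\<exists>N0. \<forall>N\<ge>N0. \<forall>A. 1 \<le> A \<longrightarrow> real A \<le> 2 * exp (\<alpha> * real N) \<longrightarrow>
    (\<exists>M c \<tau> \<phi>. N \<ge> 1 \<and> M \<ge> 2 \<and> stopping_time_seq \<tau> \<and>
      ennreal R * delay Q star A M N c \<tau> \<le> ennreal (ln (real M)) \<and>
      err_prob Q star A M N c \<tau> \<phi> \<le> \<epsilon>)"
proof -
  define d where "d = CARD('x \<times> 'y)"
  obtain \<eta>1 \<gamma>1 where g1: "\<eta>1 > 0" "\<gamma>1 > 0" and miss1': "\<forall>i x L1 L2. 1 \<le> i \<longrightarrow>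
     (\<forall>j\<in>{1..i}. pmf P (x j) \<noteq> 0) \<longrightarrow> near_type P \<eta>1 i x \<longrightarrow> L1 \<le> real i * r1 \<longrightarrow> L2 \<le> real i * r2 \<longrightarrow>
     miss_prob P Q star L1 L2 i x \<le> real ((i + 1) ^ CARD('x \<times> 'y)) * exp (- (real i * (0 + \<gamma>1)))"
    using miss_prob_bound[OF gapk] by (elim exE conjE) (rule that)
  note miss1 = miss1'[folded d_def, rule_format]
  obtain \<eta>2 \<gamma>2 where g2: "\<eta>2 > 0" "\<gamma>2 > 0" and miss2': "\<forall>i x L1 L2. 1 \<le> i \<longrightarrow>
     (\<forall>j\<in>{1..i}. pmf P (x j) \<noteq> 0) \<longrightarrow> near_type P \<eta>2 i x \<longrightarrow> L1 \<le> real i * s1 \<longrightarrow> L2 \<le> real i * s2 \<longrightarrow>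
     miss_prob P Q star L1 L2 i x \<le> real ((i + 1) ^ CARD('x \<times> 'y)) * exp (- (real i * (\<alpha> + \<gamma>2)))"
    using miss_prob_bound[OF gapN] by (elim exE conjE) (rule that)
  note miss2 = miss2'[folded d_def, rule_format]
  define \<eta> where "\<eta> = min \<eta>1 \<eta>2"
  have "0 < \<eta>" using g1 g2 by (simp add: \<eta>_def)
  then obtain \<gamma>0 where g0: "\<gamma>0 > 0" and atyp: "\<And>i. 1 \<le> i \<Longrightarrow>
      (\<Sum>x\<in>{x\<in>seqs i. \<not> near_type P \<eta> i x}. \<Prod>j=1..i. pmf P (x j))
       \<le> real ((i + 1) ^ CARD('x)) * exp (- (real i * \<gamma>0))"
    using atypical_bound[of \<eta> P] by blast
  \<comment> \<open>The exponents left after the union bounds M A exp(-L1 - L2) on noise and M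
    exp(-L2) during transmission.\<close>
  define \<sigma>1 \<sigma>2 where "\<sigma>1 = s1 + s2 - \<alpha> - \<beta>" and "\<sigma>2 = s2 - \<beta>"
  have \<sigma>: "0 < \<sigma>1" "0 < \<sigma>2" using s by (auto simp: \<sigma>1_def \<sigma>2_def)
  \<comment> \<open>The 3 pays for rounding \<open>k\<close> up and for the two miss contributions
    to the delay, each at most 1.\<close>
  have lin: "eventually (\<lambda>N. R * (\<kappa> * real N + 3) \<le> \<beta> * real N) sequentially"
    using R by real_asymp
  \<comment> \<open>Twice 1/4 leaves typicality with probability at least 1/2. The constants 16 and
    8 of the union bounds turn \<epsilon> / 32 into \<epsilon> / 2 and \<epsilon> / 4; misses take
    the remaining \<epsilon> / 4.\<close>
  have "eventually (\<lambda>N. 1 \<le> N \<and> R * (\<kappa> * real N + 3) \<le> \<beta> * real N \<and>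
      real ((N + 1) ^ CARD('x)) * exp (- (\<kappa> * \<gamma>0 * real N)) \<le> 1 / 4 \<and>
      real ((N + 1) ^ (d + 1)) * exp (- (\<kappa> * \<gamma>1 * real N)) \<le> 1 \<and>
      real ((N + 1) ^ (d + 1)) * exp (- (\<gamma>2 * real N)) \<le> min (1 / 2) (\<epsilon> / 4) \<and>
      real ((N + 1) ^ (d + CARD('y))) * exp (- (\<sigma>1 * real N)) \<le> \<epsilon> / 32 \<and>
      real ((N + 1) ^ (d + 1)) * exp (- (\<sigma>2 * real N)) \<le> \<epsilon> / 32) sequentially"
    using \<epsilon> \<kappa> g0 g1 g2 \<sigma>
    by (intro eventually_conj eventually_ge_at_top lin eventually_poly_exp_le) auto
  then obtain N0 where N0: "\<And>N. N \<ge> N0 \<Longrightarrow> 1 \<le> N \<and> R * (\<kappa> * real N + 3) \<le> \<beta> * real N \<and>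
      real ((N + 1) ^ CARD('x)) * exp (- (\<kappa> * \<gamma>0 * real N)) \<le> 1 / 4 \<and>
      real ((N + 1) ^ (d + 1)) * exp (- (\<kappa> * \<gamma>1 * real N)) \<le> 1 \<and>
      real ((N + 1) ^ (d + 1)) * exp (- (\<gamma>2 * real N)) \<le> min (1 / 2) (\<epsilon> / 4) \<and>
      real ((N + 1) ^ (d + CARD('y))) * exp (- (\<sigma>1 * real N)) \<le> \<epsilon> / 32 \<and>
      real ((N + 1) ^ (d + 1)) * exp (- (\<sigma>2 * real N)) \<le> \<epsilon> / 32"
    unfolding eventually_sequentially by blast
  show ?thesis
  proof (rule exI[of _ N0], intro allI impI)
    fix N A assume "N0 \<le> N" and A: "1 \<le> A" "real A \<le> 2 * exp (\<alpha> * real N)"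
    note * = N0[OF \<open>N0 \<le> N\<close>]
    have N: "1 \<le> N" using * by blast
    define k where "k = nat \<lceil>\<kappa> * real N\<rceil>"
    have kpos: "0 < \<kappa> * real N" using \<kappa> N by simp
    have k_ge: "\<kappa> * real N \<le> real k" and k_le: "real k \<le> \<kappa> * real N + 1"
      unfolding k_def using kpos by linarith+
    have k1: "1 \<le> k" using k_ge kpos by (cases k) auto
    have "\<kappa> * real N \<le> 1 * real N" using \<kappa> by (intro mult_right_mono) auto
    then have kN: "k \<le> N" unfolding k_def by (simp add: ceiling_le_iff nat_le_iff)
    define ks where "ks = {k, N}"
    have ks: "finite ks" "real (card ks) \<le> 2" "k \<in> ks" "N \<in> ks" "\<And>i. i \<in> ks \<Longrightarrow> i \<le> N"
      unfolding ks_def using kN card_insert_le_m1[of 2 "{N}" k] by auto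
    define M where "M = nat \<lceil>exp (\<beta> * real N)\<rceil>"
    have expgt: "1 < exp (\<beta> * real N)" using \<beta> N by simp
    have M_ge: "exp (\<beta> * real N) \<le> real M" unfolding M_def by linarith
    have M_le: "real M \<le> 2 * exp (\<beta> * real N)"
      unfolding M_def using expgt by linarith
    have M2: "2 \<le> M" using M_ge expgt by linarith
    have lnM: "\<beta> * real N \<le> ln (real M)"
      using M_ge M2 by (simp add: ln_ge_iff)
    \<comment> \<open>The absolute thresholds are common to both window lengths, since the false
      alarm bounds do not depend on the length except polynomially.\<close>
    define L1 L2 where "L1 = real N * s1" and "L2 = real N * s2"
    have L: "L1 \<le> real k * r1" "L2 \<le> real k * r2"
    proof -
      have "L1 \<le> real N * (\<kappa> * r1)" "L2 \<le> real N * (\<kappa> * r2)"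
        unfolding L1_def L2_def using sr by (auto intro!: mult_left_mono)
      moreover have "real N * (\<kappa> * r1) \<le> real k * r1" "real N * (\<kappa> * r2) \<le> real k * r2"
        using mult_right_mono[OF k_ge r(1)] mult_right_mono[OF k_ge r(2)] by (simp_all add: mult_ac)
      ultimately show "L1 \<le> real k * r1" "L2 \<le> real k * r2" by linarith+
    qed
    have pw: "real ((i + 1) ^ e) \<le> real ((N + 1) ^ e)" if "i \<le> N" for i e
      using that by (intro of_nat_mono power_mono) auto
    define G where "G = {x. near_type P \<eta> k x \<and> near_type P \<eta> N x}"
    have half: "1 / 2 \<le> measure_pmf.prob (iid N P) G"
    proof -
      have bad: "measure_pmf.prob (iid N P) {x. \<not> near_type P \<eta> i x} \<le> 1 / 4"
        if i: "1 \<le> i" "i \<le> N" "\<kappa> * real N \<le> real i" for i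
      proof -
        have wl: "window_local i (\<lambda>x. \<not> near_type P \<eta> i x)"
          using near_type_local[of i P \<eta>] unfolding window_local_def by simp
        have "measure_pmf.prob (iid N P) {x. \<not> near_type P \<eta> i x}
           = (\<Sum>x\<in>{x\<in>seqs i. \<not> near_type P \<eta> i x}. \<Prod>j=1..i. pmf P (x j))"
          by (rule trans[OF prob_iid_prefix[OF i(2) wl] prob_iid])
        also have "\<dots> \<le> real ((i + 1) ^ CARD('x)) * exp (- (real i * \<gamma>0))" by (rule atyp[OF i(1)])
        also have "\<dots> \<le> real ((N + 1) ^ CARD('x)) * exp (- (\<kappa> * \<gamma>0 * real N))"
          using mult_right_mono[OF i(3), of \<gamma>0] g0 i
          by (intro mult_mono pw) (auto simp: mult_ac)
        finally show ?thesis using * by linarith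
      qed
      have "\<kappa> * real N \<le> real N" using kN k_ge by linarith
      then have "measure_pmf.prob (iid N P) {x. \<not> near_type P \<eta> k x} \<le> 1 / 4"
        "measure_pmf.prob (iid N P) {x. \<not> near_type P \<eta> N x} \<le> 1 / 4"
        using bad k1 kN k_ge N by blast+
      moreover have "measure_pmf.prob (iid N P) (- G) \<le>
          measure_pmf.prob (iid N P) {x. \<not> near_type P \<eta> k x} + measure_pmf.prob (iid N P) {x. \<not> near_type P \<eta> N x}"
      proof -
        have "- G = {x. \<not> near_type P \<eta> k x} \<union> {x. \<not> near_type P \<eta> N x}" by (auto simp: G_def)
        then show ?thesis by (simp add: measure_subadditive)
      qed
      moreover have "measure_pmf.prob (iid N P) (- G) = 1 - measure_pmf.prob (iid N P) G"
        using measure_pmf.prob_compl[of G "iid N P"] by (simp add: Compl_eq_Diff_UNIV)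
      ultimately show ?thesis by linarith
    qed
    define p where "p = cond_pmf (iid N P) G"
    have p: "finite (set_pmf p)" "set_pmf p = set_pmf (iid N P) \<inter> G"
      "\<And>S. measure_pmf.prob p S \<le> 2 * measure_pmf.prob (iid N P) S"
      unfolding p_def using prob_cond_pmf_le[OF half finite_set_iid] finite_set_iid[of N P] by auto
    define B1 B2 where "B1 = real ((N + 1) ^ CARD('y)) * exp (- L1)"
      and "B2 = 2 * (real ((N + 1) ^ d) * exp (- L2))"
    have "\<exists>c. (\<forall>m<M. c m \<in> set_pmf p) \<and>
      (\<Sum>m<M. \<Sum>l\<in>{1..A}. (\<Sum>m'<M. \<Sum>n<l. \<Sum>i\<in>ks. fa_noise P (Q star) L1 L2 i (c m'))
       + (\<Sum>m'\<in>{..<M}-{m}. \<Sum>n\<in>{l..l+N-1}. \<Sum>i\<in>ks. fa_wrong P Q star L1 L2 N c m l n i m'))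
      \<le> real A * real M * (real M * real A * real (card ks) * (B1 * B2) + real M * real N * real (card ks) * B2)"
    proof (rule random_code[OF p(1) ks(1)])
      fix i and u :: "nat \<Rightarrow> 'y" assume "i \<in> ks"
      then have i: "i \<le> N" by (rule ks)
      have "measure_pmf.prob p {x. codeword_test P L2 i x u} \<le> 2 * measure_pmf.prob (iid N P) {x. codeword_test P L2 i x u}"
        by (rule p)
      also have "\<dots> \<le> 2 * (real ((i + 1) ^ d) * exp (- L2))"
        unfolding prob_iid d_def by (intro mult_left_mono code_false_alarm i) simp
      also have "\<dots> \<le> B2"
        unfolding B2_def by (intro mult_left_mono mult_right_mono pw i) auto
      finally show "measure_pmf.prob p {x. codeword_test P L2 i x u} \<le> B2" .
    next
      fix i assume "i \<in> ks"
      then have i: "i \<le> N" by (rule ks)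
      show "(\<Sum>u\<in>{u \<in> seqs i. noise_test (Q star) L1 i u}. \<Prod>j = 1..i. pmf (Q star) (u j)) \<le> B1"
        unfolding B1_def
        by (rule order_trans[OF noise_false_alarm]) (intro mult_right_mono pw i, simp)
    qed (auto simp: B1_def B2_def)
    then obtain c where c: "\<And>m. m < M \<Longrightarrow> c m \<in> set_pmf p"
      and cF: "(\<Sum>m<M. \<Sum>l\<in>{1..A}. (\<Sum>m'<M. \<Sum>n<l. \<Sum>i\<in>ks. fa_noise P (Q star) L1 L2 i (c m'))
       + (\<Sum>m'\<in>{..<M}-{m}. \<Sum>n\<in>{l..l+N-1}. \<Sum>i\<in>ks. fa_wrong P Q star L1 L2 N c m l n i m'))
      \<le> real A * real M * (real M * real A * real (card ks) * (B1 * B2) + real M * real N * real (card ks) * B2)"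
      by blast
    have cw: "\<forall>j\<in>{1..N}. pmf P (c m j) \<noteq> 0" "near_type P \<eta> k (c m)" "near_type P \<eta> N (c m)"
      if "m < M" for m
      using c[OF that] set_iid[of "c m" N P] by (auto simp: p(2) G_def)
    have near: "near_type P \<eta>1 i x" "near_type P \<eta>2 i x" if "near_type P \<eta> i x" for i x
      using that by (auto simp: near_type_def \<eta>_def)
    define p1 p2 where "p1 = real ((N + 1) ^ d) * exp (- (\<kappa> * \<gamma>1 * real N))"
      and "p2 = real ((N + 1) ^ d) * exp (- (real N * (\<alpha> + \<gamma>2)))"
    have p1: "miss_prob P Q star L1 L2 k (c m) \<le> p1" if m: "m < M" for m
    proof -
      have "miss_prob P Q star L1 L2 k (c m) \<le> real ((k + 1) ^ d) * exp (- (real k * (0 + \<gamma>1)))"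
        by (rule miss1[OF k1 _ _ L]) (use cw[OF m] near kN N in auto)
      also have "\<dots> \<le> p1"
        unfolding p1_def using mult_right_mono[OF k_ge, of \<gamma>1] g1
        by (intro mult_mono pw kN) (auto simp: mult_ac)
      finally show ?thesis .
    qed
    have p2: "miss_prob P Q star L1 L2 N (c m) \<le> p2" if m: "m < M" for m
      unfolding p2_def
      by (rule miss2[OF N]) (use cw[OF m] near N in \<open>auto simp: L1_def L2_def\<close>)
    define acc where "acc = accept P (Q star) L1 L2"
    define T where "T = A + N - 1"
    let ?\<tau> = "\<lambda>y. enat (stop_at acc ks c M T y)" and ?\<phi> = "decode acc ks c M"
    have loc: "window_local i (acc i x)" for i x unfolding acc_def by (rule accept_local)
    have st: "stopping_time_seq ?\<tau>" by (rule stopping_time_stop_at) (rule loc)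
    have e\<alpha>: "1 \<le> exp (\<alpha> * real N)" using \<alpha> by simp
    have pwS: "real ((N + 1) ^ (d + 1)) = real (N + 1) * real ((N + 1) ^ d)" by (simp add: algebra_simps)
    have Np1: "real N * p1 \<le> 1"
    proof -
      have "real N * p1 \<le> real (N + 1) * p1" unfolding p1_def by (intro mult_right_mono) auto
      also have "\<dots> = real ((N + 1) ^ (d + 1)) * exp (- (\<kappa> * \<gamma>1 * real N))"
        unfolding p1_def pwS by (rule mult.assoc[symmetric])
      finally show ?thesis using * by linarith
    qed
    have p2_eq: "p2 = real ((N + 1) ^ d) * (exp (- (\<alpha> * real N)) * exp (- (\<gamma>2 * real N)))"
      by (simp add: p2_def exp_add[symmetric] algebra_simps)
    \<comment> \<open>The factor exp(-\<alpha> N) inside \<open>p2\<close> cancels the growth of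
      \<open>A\<close>; \<gamma>2 beats the polynomial.\<close>
    have ANp2: "real (A + N) * p2 \<le> 1"
    proof -
      have "real N \<le> real N * exp (\<alpha> * real N)" using e\<alpha> by (simp add: mult_le_cancel_left1)
      then have "real (A + N) \<le> (2 + real N) * exp (\<alpha> * real N)"
        using A(2) by (simp add: distrib_right)
      also have "\<dots> \<le> (2 * real (N + 1)) * exp (\<alpha> * real N)" by (intro mult_right_mono) auto
      finally have "real (A + N) * p2 \<le> (2 * real (N + 1)) * exp (\<alpha> * real N) * p2"
        by (rule mult_right_mono) (simp add: p2_def)
      also have "\<dots> = 2 * (real ((N + 1) ^ (d + 1)) * exp (- (\<gamma>2 * real N))) *
          (exp (\<alpha> * real N) * exp (- (\<alpha> * real N)))"
        unfolding p2_eq pwS by algebra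
      also have "exp (\<alpha> * real N) * exp (- (\<alpha> * real N)) = 1" by (simp add: exp_minus)
      finally show ?thesis using * by linarith
    qed
    have p2\<epsilon>: "p2 \<le> \<epsilon> / 4"
    proof -
      have "exp (- (\<alpha> * real N)) \<le> 1" using \<alpha> by simp
      then have "p2 \<le> real ((N + 1) ^ (d + 1)) * (1 * exp (- (\<gamma>2 * real N)))"
        unfolding p2_eq by (intro mult_mono of_nat_mono power_increasing) auto
      then show ?thesis using * by simp
    qed
    have delay: "ennreal R * delay Q star A M N c ?\<tau> \<le> ennreal (ln (real M))"
    proof (cases "R \<le> 0")
      case False
      have "delay Q star A M N c ?\<tau> \<le> ennreal (real k + real N * p1 + real (A + N) * p2)"
        unfolding acc_def T_def
        by (rule delay_le[OF A(1) _ k1 kN ks(3) N ks(4) p1 p2]) (use M2 in auto)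
      also have "\<dots> \<le> ennreal (\<kappa> * real N + 3)"
        using Np1 ANp2 k_le by (intro ennreal_leI) linarith
      finally have "ennreal R * delay Q star A M N c ?\<tau> \<le> ennreal R * ennreal (\<kappa> * real N + 3)"
        by (rule mult_left_mono) simp
      also have "\<dots> = ennreal (R * (\<kappa> * real N + 3))"
        using False kpos by (subst ennreal_mult) auto
      also have "\<dots> \<le> ennreal (ln (real M))"
        using * lnM by (intro ennreal_leI) linarith
      finally show ?thesis .
    qed (simp add: ennreal_neg)
    \<comment> \<open>The constant 16 collects four factors 2: the ceilings in \<open>M\<close> and
      \<open>A\<close>, the two window lengths, and the conditioning.\<close>
    have MAB: "real M * real A * real (card ks) * (B1 * B2) \<le> \<epsilon> / 2"
    proof -
      have "real M * real A * real (card ks) * (B1 * B2)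
        \<le> (2 * exp (\<beta> * real N)) * (2 * exp (\<alpha> * real N)) * 2 * (B1 * B2)"
        by (intro mult_mono mult_right_mono M_le A ks) (auto simp: B1_def B2_def)
      also have "\<dots> = 16 * (real ((N + 1) ^ (d + CARD('y))) *
          (exp (\<beta> * real N) * exp (\<alpha> * real N) * exp (- L1) * exp (- L2)))"
        unfolding B1_def B2_def power_add of_nat_mult by algebra
      also have "exp (\<beta> * real N) * exp (\<alpha> * real N) * exp (- L1) * exp (- L2) = exp (- (\<sigma>1 * real N))"
        by (simp add: exp_add[symmetric] \<sigma>1_def L1_def L2_def algebra_simps)
      finally show ?thesis using * by linarith
    qed
    have MNB: "real M * real N * real (card ks) * B2 \<le> \<epsilon> / 4"
    proof -
      have "real M * real N * real (card ks) * B2 \<le> (2 * exp (\<beta> * real N)) * real (N + 1) * 2 * B2"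
        by (intro mult_mono mult_right_mono M_le ks) (auto simp: B2_def)
      also have "\<dots> = 8 * (real ((N + 1) ^ (d + 1)) * (exp (\<beta> * real N) * exp (- L2)))"
        unfolding B2_def pwS by algebra
      also have "exp (\<beta> * real N) * exp (- L2) = exp (- (\<sigma>2 * real N))"
        by (simp add: exp_add[symmetric] \<sigma>2_def L2_def algebra_simps)
      finally show ?thesis using * by linarith
    qed
    have AM: "0 < real A * real M" using A M2 by simp
    have "(\<Sum>m<M. \<Sum>l\<in>{1..A}. measure (out_meas Q star N c m l) (err_event ?\<tau> ?\<phi> m))
      \<le> (\<Sum>m<M. \<Sum>l\<in>{1..A}. ((\<Sum>m'<M. \<Sum>n<l. \<Sum>i\<in>ks. fa_noise P (Q star) L1 L2 i (c m'))
       + (\<Sum>m'\<in>{..<M}-{m}. \<Sum>n\<in>{l..l+N-1}. \<Sum>i\<in>ks. fa_wrong P Q star L1 L2 N c m l n i m')) + p2)"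
    proof (intro sum_mono)
      fix m l assume ml: "m \<in> {..<M}" "l \<in> {1..A}"
      have "measure (out_meas Q star N c m l) (err_event ?\<tau> ?\<phi> m)
        \<le> (\<Sum>m'<M. \<Sum>n<l. \<Sum>i\<in>ks. fa_noise P (Q star) L1 L2 i (c m'))
       + (\<Sum>m'\<in>{..<M}-{m}. \<Sum>n\<in>{l..l+N-1}. \<Sum>i\<in>ks. fa_wrong P Q star L1 L2 N c m l n i m')
       + miss_prob P Q star L1 L2 N (c m)"
        unfolding acc_def T_def by (rule err_event_measure_le) (use ml N ks in auto)
      then show "measure (out_meas Q star N c m l) (err_event ?\<tau> ?\<phi> m)
        \<le> ((\<Sum>m'<M. \<Sum>n<l. \<Sum>i\<in>ks. fa_noise P (Q star) L1 L2 i (c m'))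
       + (\<Sum>m'\<in>{..<M}-{m}. \<Sum>n\<in>{l..l+N-1}. \<Sum>i\<in>ks. fa_wrong P Q star L1 L2 N c m l n i m')) + p2"
        using p2[of m] ml by simp
    qed
    also have "\<dots> \<le> real A * real M * (\<epsilon> / 2 + \<epsilon> / 4) + real A * real M * (\<epsilon> / 4)"
    proof -
      have "real A * real M * (real M * real A * real (card ks) * (B1 * B2) + real M * real N * real (card ks) * B2)
        \<le> real A * real M * (\<epsilon> / 2 + \<epsilon> / 4)"
        using AM by (intro mult_left_mono add_mono MAB MNB) auto
      moreover have "(\<Sum>m<M. \<Sum>l\<in>{1..A}. p2) \<le> real A * real M * (\<epsilon> / 4)"
        using mult_left_mono[OF p2\<epsilon>, of "real A * real M"] AM by (simp add: mult_ac)
      ultimately show ?thesis using cF by (simp only: sum.distrib)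
    qed
    also have "\<dots> = \<epsilon> * (real A * real M)" by (simp add: algebra_simps)
    finally have err: "err_prob Q star A M N c ?\<tau> ?\<phi> \<le> \<epsilon>"
      unfolding err_prob_def using AM by (simp add: pos_divide_le_eq)
    show "\<exists>M c \<tau> \<phi>. N \<ge> 1 \<and> M \<ge> 2 \<and> stopping_time_seq \<tau> \<and>
      ennreal R * delay Q star A M N c \<tau> \<le> ennreal (ln (real M)) \<and>
      err_prob Q star A M N c \<tau> \<phi> \<le> \<epsilon>"
      by (intro exI[of _ M] exI[of _ c] exI[of _ ?\<tau>] exI[of _ ?\<phi>] conjI N M2 st delay err)
  qed
qed

section \<open>The theorem\<close>

lemma KL_self: "KL p p = 0"
  by (subst KL_eq) (auto simp: zero_ereal_def intro!: sum.neutral)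

lemma divergences_of_miss:
  fixes Q :: "'x::finite \<Rightarrow> 'y::finite pmf"
  assumes J: "J \<in> feasible Q" "J \<in> miss_set P W r1 r2" "marg_fst J = pmf P"
  obtains V where "KL (joint P V) (joint P Q) = ereal (cond_div Q J)"
    "cond_div Q J \<le> 0 \<Longrightarrow> joint P V = joint P Q"
    "mutual_info (joint P V) \<le> r2 \<or> KL (out_marg P V) W \<le> ereal r1"
    "KL (out_marg P V) (out_marg P Q) \<le> KL (joint P V) (joint P Q)"
proof -
  obtain V where V: "\<And>z. pmf (joint P V) z = J $ z"
    using feasible_joint[OF J(1,3)] by blast
  note d = divergences_of_joint[OF J(1) V]
  have "mutual_info (joint P V) \<le> r2 \<or> KL (out_marg P V) W \<le> ereal r1"
  proof (cases "info_div P J \<le> r2")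
    case False
    then have n: "\<And>b. pmf W b = 0 \<Longrightarrow> marg_snd J b = 0" "noise_div W J \<le> r1"
      using J(2) by (auto simp: miss_set_def)
    show ?thesis using d(6)[OF n(1)] n(2) by simp
  qed (simp add: d(4))
  then show thesis using that d(3,5,7) by simp
qed

theorem theorem2:
  fixes Q :: "'x::finite \<Rightarrow> 'y::finite pmf" and star :: 'x
    and P :: "'x pmf" and \<alpha> t1 t2 \<delta> :: real
  assumes reach: "\<forall>y. \<exists>x. pmf (Q x) y > 0"
    and cap_pos: "capacity Q > 0"
    and alpha_nn: "\<alpha> \<ge> 0" and t1_nn: "t1 \<ge> 0" and t2_gt: "t2 > 1"
    and I_pos: "mutual_info (joint P Q) > 0"
    and delta: "0 < \<delta>" "\<delta> < 1"
    and cond_a: "ereal \<alpha> < (INF V \<in> {V. KL (out_marg P V) (Q star)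
                         < ereal (t1 * \<alpha> / (\<delta> * (t1 + t2 - 1)))}.
                     KL (out_marg P V) (out_marg P Q))"
    and cond_b: "ereal \<alpha> < (INF V \<in> {V. mutual_info (joint P V)
                         \<le> t2 * \<alpha> / (\<delta> * (t1 + t2 - 1))}.
                     KL (joint P V) (joint P Q))"
    and cond_c: "ereal (t1 / t2) < KL (out_marg P Q) (Q star) / ereal (mutual_info (joint P Q))"
  shows "achievable Q star \<alpha> (mutual_info (joint P Q) / t2)"
proof -
  define I where "I = mutual_info (joint P Q)"
  have I: "0 < I" using I_pos by (simp add: I_def)
  have t: "0 < t1 + t2 - 1" "0 < t2" using t1_nn t2_gt by auto
  have noise: "ereal (t1 / t2 * I) < KL (out_marg P Q) (Q star)"
    using cond_c I unfolding I_def[symmetric]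
    by (subst (asm) ereal_less_divide_pos) (auto simp: mult.commute)
  define gap where "gap a r1 r2 \<longleftrightarrow> (\<forall>J\<in>feasible Q \<inter> miss_set P (Q star) r1 r2. marg_fst J = pmf P \<longrightarrow> a < cond_div Q J)"
    for a r1 r2 :: real
  \<comment> \<open>Zero divergence forces the law PQ, which lies strictly beyond both thresholds
    and so cannot be missed.\<close>
  have gap0: "gap 0 r1 r2" if r: "r2 < I" "ereal r1 < KL (out_marg P Q) (Q star)" for r1 r2
    unfolding gap_def
  proof (intro ballI impI)
    fix J assume J: "J \<in> feasible Q \<inter> miss_set P (Q star) r1 r2" "marg_fst J = pmf P"
    obtain V where V: "cond_div Q J \<le> 0 \<Longrightarrow> joint P V = joint P Q"
      "mutual_info (joint P V) \<le> r2 \<or> KL (out_marg P V) (Q star) \<le> ereal r1"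
      by (rule divergences_of_miss[OF IntD1[OF J(1)] IntD2[OF J(1)] J(2)]) (rule that)
    show "0 < cond_div Q J"
    proof (rule ccontr)
      assume "\<not> 0 < cond_div Q J"
      then have "joint P V = joint P Q" by (intro V(1)) simp
      then show False using V(2) r by (auto simp: out_marg_def I_def)
    qed
  qed
  \<comment> \<open>\<open>\<beta>\<close> is the exponent of the number of messages; for \<open>\<alpha> = 0\<close> the value suggested by (a) and (b) is \<open>0\<close>,
    and any small positive value works instead.\<close>
  obtain \<beta> where \<beta>: "0 < \<beta>" "\<alpha> < (t1 + t2 - 1) * \<beta>" "t2 * \<beta> < I"
    and gap: "\<And>r. r < t1 * \<beta> \<Longrightarrow> gap \<alpha> r (t2 * \<beta>)"
  proof (cases "\<alpha> = 0")
    case True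
    show thesis
    proof (rule that[of "I / (2 * t2)"])
      fix r assume "r < t1 * (I / (2 * t2))"
      also have "\<dots> \<le> t1 / t2 * I" using t1_nn t I by (simp add: field_simps)
      finally have "ereal r < KL (out_marg P Q) (Q star)"
        using noise by (meson ereal_less_eq(3) less_imp_le order_le_less_trans)
      moreover have "t2 * (I / (2 * t2)) < I" using t I by simp
      ultimately show "gap \<alpha> r (t2 * (I / (2 * t2)))" unfolding True by (intro gap0)
    qed (use t I True in auto)
  next
    case False
    then have \<alpha>: "0 < \<alpha>" using alpha_nn by simp
    \<comment> \<open>\<delta> < 1 makes (t1 + t2 - 1) \<beta> = \<alpha> / \<delta> strictly larger
      than \<alpha>.\<close>
    define \<beta> where "\<beta> = \<alpha> / (\<delta> * (t1 + t2 - 1))"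
    have b: "t1 * \<alpha> / (\<delta> * (t1 + t2 - 1)) = t1 * \<beta>" "t2 * \<alpha> / (\<delta> * (t1 + t2 - 1)) = t2 * \<beta>"
      by (simp_all add: \<beta>_def)
    have lb: "ereal \<alpha> < KL (joint P V) (joint P Q)" if "mutual_info (joint P V) \<le> t2 * \<beta>" for V
      by (rule less_le_trans[OF cond_b]) (rule INF_lower, use that b in simp)
    have la: "ereal \<alpha> < KL (out_marg P V) (out_marg P Q)" if "KL (out_marg P V) (Q star) < ereal (t1 * \<beta>)" for V
      by (rule less_le_trans[OF cond_a]) (rule INF_lower, use that b in simp)
    show thesis
    proof (rule that[of \<beta>])
      show "0 < \<beta>" using \<alpha> t delta by (simp add: \<beta>_def)
      have "(t1 + t2 - 1) * \<beta> = \<alpha> / \<delta>" using t delta by (simp add: \<beta>_def)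
      moreover have "\<alpha> < \<alpha> / \<delta>" using \<alpha> delta by (simp add: field_simps)
      ultimately show "\<alpha> < (t1 + t2 - 1) * \<beta>" by simp
      \<comment> \<open>Otherwise \<open>V = Q\<close> would be admissible in (b), giving \<alpha> <
        KL(PQ, PQ) = 0.\<close>
      show "t2 * \<beta> < I"
        using lb[of Q] \<alpha> by (force simp: I_def KL_self)
      fix r assume r: "r < t1 * \<beta>"
      show "gap \<alpha> r (t2 * \<beta>)"
        unfolding gap_def
      proof (intro ballI impI)
        fix J assume J: "J \<in> feasible Q \<inter> miss_set P (Q star) r (t2 * \<beta>)" "marg_fst J = pmf P"
        obtain V where V: "KL (joint P V) (joint P Q) = ereal (cond_div Q J)"
          "mutual_info (joint P V) \<le> t2 * \<beta> \<or> KL (out_marg P V) (Q star) \<le> ereal r"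
          "KL (out_marg P V) (out_marg P Q) \<le> KL (joint P V) (joint P Q)"
          by (rule divergences_of_miss[OF IntD1[OF J(1)] IntD2[OF J(1)] J(2)]) (rule that)
        have "ereal \<alpha> < KL (joint P V) (joint P Q)"
          using V(2)
        proof
          assume "KL (out_marg P V) (Q star) \<le> ereal r"
          also have "\<dots> < ereal (t1 * \<beta>)" using r by simp
          finally show ?thesis using la[of V] V(3) by (meson less_le_trans)
        qed (rule lb)
        then show "\<alpha> < cond_div Q J" by (simp add: V(1))
      qed
    qed
  qed
  \<comment> \<open>The hypothesis (a) is a strict sublevel set while the compactness argument needs a closed one, so
    the noise threshold is lowered by \<open>\<sigma>\<close>; the slack comes from \<open>\<delta> < 1\<close>.\<close>
  define \<sigma> where "\<sigma> = ((t1 + t2 - 1) * \<beta> - \<alpha>) / 2"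
  have \<sigma>: "0 < \<sigma>" using \<beta> by (simp add: \<sigma>_def)
  show ?thesis
    unfolding achievable_def Let_def I_def[symmetric]
  proof (intro allI impI)
    fix \<epsilon> :: real assume \<epsilon>: "0 < \<epsilon>"
    let ?R = "I / t2 - \<epsilon>"
    \<comment> \<open>The lower bound on \<kappa> makes the short window reliable, the last
      inequality makes it short enough for the rate; the loss \<epsilon> leaves room between
      them.\<close>
    have "\<exists>\<kappa>>t2 * \<beta> / I. \<kappa> < 1 \<and> ?R * \<kappa> < \<beta>"
    proof (cases "?R \<le> 0")
      case True
      obtain \<kappa> where \<kappa>: "t2 * \<beta> / I < \<kappa>" "\<kappa> < 1" using dense[of "t2 * \<beta> / I" 1] \<beta> I by auto
      moreover have "0 < \<kappa>" using \<kappa>(1) t \<beta> I by (meson divide_pos_pos less_trans mult_pos_pos)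
      ultimately show ?thesis
        using True \<beta>(1) mult_nonpos_nonneg[of ?R \<kappa>] by (intro exI[of _ \<kappa>]) auto
    next
      case False
      have "t2 * \<beta> / I < \<beta> / ?R"
        using False \<beta>(1) I t \<epsilon> by (simp add: field_simps)
      then obtain \<kappa> where \<kappa>: "t2 * \<beta> / I < \<kappa>" "\<kappa> < min 1 (\<beta> / ?R)"
        using dense[of "t2 * \<beta> / I" "min 1 (\<beta> / ?R)"] \<beta> I by auto
      then have "?R * \<kappa> < \<beta>" using False by (simp add: pos_less_divide_eq mult.commute)
      then show ?thesis using \<kappa> by auto
    qed
    then obtain \<kappa> where \<kappa>: "t2 * \<beta> / I < \<kappa>" "\<kappa> < 1" "?R * \<kappa> < \<beta>" by blast
    have \<kappa>0: "0 < \<kappa>" using \<kappa>(1) t \<beta> I by (meson divide_pos_pos less_trans mult_pos_pos)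
    have \<kappa>I: "t2 * \<beta> / \<kappa> < I" using \<kappa>(1) \<kappa>0 I by (simp add: field_simps)
    \<comment> \<open>Here (c) enters: a codeword threshold below I(PQ) forces a noise threshold
      below the divergence of the output law from noise.\<close>
    have "t1 / t2 * (t2 * \<beta> / \<kappa>) \<le> t1 / t2 * I"
      using \<kappa>I t t1_nn by (intro mult_left_mono) auto
    then have "t1 * \<beta> / \<kappa> \<le> t1 / t2 * I" using t by simp
    then have \<kappa>noise: "ereal (t1 * \<beta> / \<kappa>) < KL (out_marg P Q) (Q star)"
      using noise by (meson ereal_less_eq(3) order_le_less_trans)
    have core: "\<exists>N0. \<forall>N\<ge>N0. \<forall>A. 1 \<le> A \<longrightarrow> real A \<le> 2 * exp (\<alpha> * real N) \<longrightarrow>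
      (\<exists>M c \<tau> \<phi>. N \<ge> 1 \<and> M \<ge> 2 \<and> stopping_time_seq \<tau> \<and>
        ennreal ?R * delay Q star A M N c \<tau> \<le> ennreal (ln (real M)) \<and>
        err_prob Q star A M N c \<tau> \<phi> \<le> \<epsilon>)"
    proof (rule achievable_core[where \<beta> = \<beta> and \<kappa> = \<kappa>])
      show "\<forall>J\<in>feasible Q \<inter> miss_set P (Q star) (t1 * \<beta> - \<sigma>) (t2 * \<beta>). marg_fst J = pmf P \<longrightarrow> \<alpha> < cond_div Q J"
        using gap[of "t1 * \<beta> - \<sigma>"] \<sigma> unfolding gap_def by simp
      show "\<forall>J\<in>feasible Q \<inter> miss_set P (Q star) (t1 * \<beta> / \<kappa>) (t2 * \<beta> / \<kappa>). marg_fst J = pmf P \<longrightarrow> 0 < cond_div Q J"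
        using gap0[OF \<kappa>I \<kappa>noise] unfolding gap_def by simp
      \<comment> \<open>\<sigma> is half of the slack, so lowering the noise threshold still leaves
        \<sigma> for the false alarms.\<close>
      show "\<alpha> + \<beta> < (t1 * \<beta> - \<sigma>) + t2 * \<beta>"
        using \<beta>(2) unfolding \<sigma>_def by (simp add: field_simps)
      show "\<beta> < t2 * \<beta>" using \<beta> t2_gt by simp
    qed (use alpha_nn \<beta> \<kappa> \<kappa>0 \<sigma> \<epsilon> t t1_nn in auto)
    then obtain N0 where N0: "\<And>N A. N \<ge> N0 \<Longrightarrow> 1 \<le> A \<Longrightarrow> real A \<le> 2 * exp (\<alpha> * real N) \<Longrightarrow>
      (\<exists>M c \<tau> \<phi>. N \<ge> 1 \<and> M \<ge> 2 \<and> stopping_time_seq \<tau> \<and>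
        ennreal ?R * delay Q star A M N c \<tau> \<le> ennreal (ln (real M)) \<and>
        err_prob Q star A M N c \<tau> \<phi> \<le> \<epsilon>)"
      by blast
    show "\<exists>N0. \<forall>N\<ge>N0. \<exists>(M::nat) c \<tau> \<phi>. 1 \<le> N \<and> 2 \<le> M \<and> stopping_time_seq \<tau> \<and>
        ennreal ?R * delay Q star (nat \<lceil>exp ((\<alpha> - \<epsilon>) * real N)\<rceil>) M N c \<tau> \<le> ennreal (ln (real M)) \<and>
        err_prob Q star (nat \<lceil>exp ((\<alpha> - \<epsilon>) * real N)\<rceil>) M N c \<tau> \<phi> \<le> \<epsilon>"
    proof (rule exI[of _ N0], intro allI impI)
      fix N assume N: "N0 \<le> N"
      let ?A = "nat \<lceil>exp ((\<alpha> - \<epsilon>) * real N)\<rceil>"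
      have e: "0 < exp ((\<alpha> - \<epsilon>) * real N)" "exp ((\<alpha> - \<epsilon>) * real N) \<le> exp (\<alpha> * real N)" "1 \<le> exp (\<alpha> * real N)"
        using \<epsilon> alpha_nn by (auto intro!: mult_right_mono)
      have "1 \<le> ?A" using e(1) by (simp add: Suc_le_eq)
      \<comment> \<open>The ceiling adds at most 1, which is at most exp(\<alpha> N) because
        \<alpha> \<ge> 0.\<close>
      moreover have "real ?A \<le> 2 * exp (\<alpha> * real N)" using e by linarith
      ultimately show "\<exists>(M::nat) c \<tau> \<phi>. 1 \<le> N \<and> 2 \<le> M \<and> stopping_time_seq \<tau> \<and>
        ennreal ?R * delay Q star ?A M N c \<tau> \<le> ennreal (ln (real M)) \<and>
        err_prob Q star ?A M N c \<tau> \<phi> \<le> \<epsilon>"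
        by (rule N0[OF N])
    qed
  qed
qed

end
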